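(* Let $\boldsymbol{\gamma}=(\gamma_j)_{j\ge1}$ be a sequence of coordinate weights in $(0,1]$. Then: (i) If $p$ is an even (positive) integer, then the $\boldsymbol{\gamma}$-weighted $L_p$-discrepancy is strongly polynomially tractable if and only if $\sum_{j=1}^{\infty}\gamma_j^{p/2}<\infty$. (ii) For every $p\in(1,\infty)$ the $\boldsymbol{\gamma}$-weighted $L_p$-discrepancy is polynomially tractable if and only if $\limsup_{d\to\infty}\frac{1}{\log d}\sum_{j=1}^d\gamma_j^{p/2}<\infty$. Sufficiency of this condition for polynomial tractability holds also for $p=1$. (iii) For every $p\in(1,\infty)$ the $\boldsymbol{\gamma}$-weighted $L_p$-discrepancy is weakly tractable if and only if $\lim_{d\to\infty}\frac1d\sum_{j=1}^d\gamma_j^{p/2}=0$. Sufficiency of this condition for weak tractability holds also for $p=1$.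
   Context: Notation: $\mathbb{N}=\{1,2,\ldots\}$, $[d]=\{1,\ldots,d\}$, and $\gamma_{\mathfrak{u}}=\prod_{j\in\mathfrak{u}}\gamma_j$ for $\mathfrak{u}\subseteq[d]$. For a set $\mathcal{P}=\{\boldsymbol{x}_1,\ldots,\boldsymbol{x}_N\}$ of $N$ points in $[0,1)^d$, the local discrepancy function is $$\Delta_{\mathcal{P}}(\boldsymbol{t})=\frac{|\{k\in\{1,\ldots,N\}:\boldsymbol{x}_k\in[0,t_1)\times\cdots\times[0,t_d)\}|}{N}-t_1t_2\cdots t_d,\qquad \boldsymbol{t}=(t_1,\ldots,t_d)\in[0,1]^d.$$ For $p\in[1,\infty)$ the weighted $L_p$-discrepancy of $\mathcal{P}$ is $$L_{p,\boldsymbol{\gamma},N}(\mathcal{P})=\Big(\sum_{\emptyset\ne\mathfrak{u}\subseteq[d]}\gamma_{\mathfrak{u}}^{p/2}\int_{[0,1]^{|\mathfrak{u}|}}|\Delta_{\mathcal{P}}((\boldsymbol{t}_{\mathfrak{u}},1))|^p\,\mathrm{d}\boldsymbol{t}_{\mathfrak{u}}\Big)^{1/p},$$ where $\boldsymbol{t}_{\mathfrak{u}}=(t_j)_{j\in\mathfrak{u}}$ and $(\boldsymbol{t}_{\mathfrak{u}},1)\in[0,1]^d$ has $j$-th coordinate $t_j$ if $j\in\mathfrak{u}$ and $1$ if $j\notin\mathfrak{u}$. For $N\in\mathbb{N}$ let $\mathrm{disc}_{p,\boldsymbol{\gamma}}(N,d)=\min_{\mathcal{P}}L_{p,\boldsymbol{\gamma},N}(\mathcal{P})$,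 the minimum (understood as an infimum) being over all $N$-element point sets in $[0,1)^d$. The initial discrepancy is $\mathrm{disc}_{p,\boldsymbol{\gamma}}(0,d)=\prod_{j=1}^d\big(1+\frac{\gamma_j^{p/2}}{p+1}\big)^{1/p}$. For $\varepsilon\in(0,1)$, $d\in\mathbb{N}$, put $$N^{\mathrm{disc}}_{p,\boldsymbol{\gamma}}(\varepsilon,d)=\min\{N\in\mathbb{N}:\mathrm{disc}_{p,\boldsymbol{\gamma}}(N,d)\le\varepsilon\,\mathrm{disc}_{p,\boldsymbol{\gamma}}(0,d)\}.$$ The $\boldsymbol{\gamma}$-weighted $L_p$-discrepancy is called - weakly tractable if $\lim_{d+\varepsilon^{-1}\to\infty}\frac{\log N^{\mathrm{disc}}_{p,\boldsymbol{\gamma}}(\varepsilon,d)}{d+\varepsilon^{-1}}=0$; - polynomially tractable if there are $C,\sigma>0$ and $\tau\ge0$ with $N^{\mathrm{disc}}_{p,\boldsymbol{\gamma}}(\varepsilon,d)\le C d^{\tau}\varepsilon^{-\sigma}$ for all $\varepsilon\in(0,1)$, $d\in\mathbb{N}$; - strongly polynomially tractable if there are $C,\sigma>0$ with $N^{\mathrm{disc}}_{p,\boldsymbol{\gamma}}(\varepsilon,d)\le C\varepsilon^{-\sigma}$ for all $\varepsilon\in(0,1)$, $d\in\mathbb{N}$. *)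

theory Defs
  imports "HOL-Analysis.Analysis"
begin

text \<open>Coordinates are indexed by \<open>{1..d}\<close>. A point of \<open>[0,1)^d\<close> is a function
  \<open>nat \<Rightarrow> real\<close> that is extensional on \<open>{1..d}\<close>, so that point sets of the right
  cardinality are counted correctly. The value \<open>\<gamma> 0\<close> of a weight sequence is never used.\<close>

definition point_sets :: "nat \<Rightarrow> nat \<Rightarrow> (nat \<Rightarrow> real) set set" where
  "point_sets N d = {P. P \<subseteq> (\<Pi>\<^sub>E j\<in>{1..d}. {0..<1}) \<and> finite P \<and> card P = N}"

definition local_disc :: "nat \<Rightarrow> (nat \<Rightarrow> real) set \<Rightarrow> (nat \<Rightarrow> real) \<Rightarrow> real" where
  "local_disc d P t =
     real (card {x\<in>P. \<forall>j\<in>{1..d}. x j \<in> {0..<t j}}) / real (card P) - (\<Prod>j\<in>{1..d}. t j)"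

definition weighted_Lp_disc :: "real \<Rightarrow> (nat \<Rightarrow> real) \<Rightarrow> nat \<Rightarrow> (nat \<Rightarrow> real) set \<Rightarrow> real" where
  "weighted_Lp_disc p \<gamma> d P =
     (\<Sum>u\<in>Pow {1..d} - {{}}. (\<Prod>j\<in>u. \<gamma> j) powr (p / 2) *
        (LINT t : (\<Pi>\<^sub>E j\<in>u. {0..1}) | (\<Pi>\<^sub>M j\<in>u. lborel).
           \<bar>local_disc d P (\<lambda>j. if j \<in> u then t j else 1)\<bar> powr p)) powr (1 / p)"

definition min_disc :: "real \<Rightarrow> (nat \<Rightarrow> real) \<Rightarrow> nat \<Rightarrow> nat \<Rightarrow> real" where
  "min_disc p \<gamma> N d = (INF P\<in>point_sets N d. weighted_Lp_disc p \<gamma> d P)"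

definition initial_disc :: "real \<Rightarrow> (nat \<Rightarrow> real) \<Rightarrow> nat \<Rightarrow> real" where
  "initial_disc p \<gamma> d = (\<Prod>j\<in>{1..d}. (1 + \<gamma> j powr (p / 2) / (p + 1)) powr (1 / p))"

text \<open>For \<open>p \<ge> 1\<close> and positive weights the minimum below exists, because
  \<open>min_disc p \<gamma> N d\<close> tends to \<open>0\<close> as \<open>N\<close> tends to infinity, for fixed \<open>d\<close>.\<close>

definition N_disc :: "real \<Rightarrow> (nat \<Rightarrow> real) \<Rightarrow> real \<Rightarrow> nat \<Rightarrow> nat" where
  "N_disc p \<gamma> \<epsilon> d = (LEAST N. N \<ge> 1 \<and> min_disc p \<gamma> N d \<le> \<epsilon> * initial_disc p \<gamma> d)"

text \<open>The filter expresses the joint limit as \<open>d + 1/\<epsilon>\<close> tends to infinity, over all pairs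
  with \<open>\<epsilon> \<in> (0,1)\<close> and \<open>d \<ge> 1\<close>.\<close>

definition weakly_tractable :: "real \<Rightarrow> (nat \<Rightarrow> real) \<Rightarrow> bool" where
  "weakly_tractable p \<gamma> \<longleftrightarrow>
     ((\<lambda>(\<epsilon>, d). ln (real (N_disc p \<gamma> \<epsilon> d)) / (real d + 1 / \<epsilon>)) \<longlongrightarrow> 0)
       (inf (filtercomap (\<lambda>(\<epsilon>, d). real d + 1 / \<epsilon>) at_top) (principal ({0<..<1} \<times> {1..})))"

definition polynomially_tractable :: "real \<Rightarrow> (nat \<Rightarrow> real) \<Rightarrow> bool" where
  "polynomially_tractable p \<gamma> \<longleftrightarrow>
     (\<exists>C \<sigma> \<tau>. C > 0 \<and> \<sigma> > 0 \<and> \<tau> \<ge> 0 \<and>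
        (\<forall>\<epsilon>\<in>{0<..<1}. \<forall>d\<ge>1. real (N_disc p \<gamma> \<epsilon> d) \<le> C * real d powr \<tau> * \<epsilon> powr (- \<sigma>)))"

definition strongly_polynomially_tractable :: "real \<Rightarrow> (nat \<Rightarrow> real) \<Rightarrow> bool" where
  "strongly_polynomially_tractable p \<gamma> \<longleftrightarrow>
     (\<exists>C \<sigma>. C > 0 \<and> \<sigma> > 0 \<and>
        (\<forall>\<epsilon>\<in>{0<..<1}. \<forall>d\<ge>1. real (N_disc p \<gamma> \<epsilon> d) \<le> C * \<epsilon> powr (- \<sigma>)))"

end

theory Submission
  imports Defs
begin

text \<open>Write \<open>g j = \<gamma> j powr (p / 2)\<close> and \<open>V t\<close> for the volume of the box \<open>[0,t)\<close>, and let \<open>J\<close> be the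
  weighted sum over all faces of the integrals of a function, so that \<open>J 1 = (\<Prod>j. 1 + g j)\<close> and
  \<open>J (V powr q) = (\<Prod>j. 1 + g j / (q + 1))\<close>.

  Lower bound: with \<open>N\<close> points, every box with \<open>V t < 1 / (2 N)\<close> has local discrepancy at least
  \<open>V t\<close>, whence the \<open>p\<close>-th power of the discrepancy is at least \<open>J (V powr p) - 2 N J (V powr (p + 1))\<close>.
  So \<open>N\<close> is at least a constant times \<open>exp (c (\<Sum>j. g j))\<close> for \<open>\<epsilon> = 1/2\<close>.

  Upper bound: choosing points greedily yields \<open>J (\<Delta>\<^sup>2) \<le> 2 J 1 / N\<close>, and \<open>\<bar>\<Delta>\<bar> \<le> 1\<close> together with
  \<open>p \<ge> 1\<close> gives \<open>J (\<bar>\<Delta>\<bar> powr p) \<le> J \<bar>\<Delta>\<bar> \<le> 2 J 1 / sqrt N\<close>. So \<open>N\<close> is at most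
  \<open>5 \<epsilon> powr (- 2 p) * exp (2 (\<Sum>j. g j))\<close>. All three criteria follow from these two bounds.\<close>

section \<open>Weighted integrals over the faces of the unit cube\<close>

definition extend1 :: "nat set \<Rightarrow> (nat \<Rightarrow> real) \<Rightarrow> nat \<Rightarrow> real" where
  "extend1 u t = (\<lambda>j. if j \<in> u then t j else 1)"

text \<open>Coordinates outside \<open>{1..d}\<close> are left free, because \<open>extend1\<close>
  fills them with \<open>1\<close> instead of \<open>undefined\<close>, so that its values are not
  extensional.\<close>

definition unit_box :: "nat \<Rightarrow> (nat \<Rightarrow> real) set" where
  "unit_box d = {t. \<forall>j\<in>{1..d}. 0 \<le> t j \<and> t j \<le> 1}"

text \<open>The functional \<open>J\<close>. It includes \<open>u = {}\<close>, whose term is the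
  value of \<open>f\<close> at the all-ones point, so that product functions integrate to full
  products over \<open>{1..d}\<close>.\<close>

definition faces_integral :: "(nat \<Rightarrow> real) \<Rightarrow> nat \<Rightarrow> ((nat \<Rightarrow> real) \<Rightarrow> real) \<Rightarrow> real" where
  "faces_integral g d f = (\<Sum>u\<in>Pow {1..d}. (\<Prod>j\<in>u. g j) *
     (LINT t : (\<Pi>\<^sub>E j\<in>u. {0..1}) | (\<Pi>\<^sub>M j\<in>u. lborel). f (extend1 u t)))"

text \<open>Measurability is asked of the restrictions to the faces, each for the Lebesgue product
  measure of its own index set, so that no sigma-algebra on all of \<open>nat => real\<close> has to
  be chosen.\<close>

definition faces_measurable :: "nat \<Rightarrow> ((nat \<Rightarrow> real) \<Rightarrow> real) set" where
  "faces_measurable d =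
     {f. \<forall>u\<subseteq>{1..d}. (\<lambda>t. f (extend1 u t)) \<in> borel_measurable (\<Pi>\<^sub>M j\<in>u. lborel)}"

definition faces_integrable :: "nat \<Rightarrow> ((nat \<Rightarrow> real) \<Rightarrow> real) set" where
  "faces_integrable d = {f. \<forall>u\<subseteq>{1..d}.
     set_integrable (\<Pi>\<^sub>M j\<in>u. lborel) (\<Pi>\<^sub>E j\<in>u. {0..1}) (\<lambda>t. f (extend1 u t))}"

lemma extend1_in_unit_box: "t \<in> (\<Pi>\<^sub>E j\<in>u. {0..1}) \<Longrightarrow> extend1 u t \<in> unit_box d"
  by (auto simp: extend1_def unit_box_def PiE_iff)

interpretation lborel_product: product_sigma_finite "\<lambda>_::nat. lborel :: real measure"
  by standard

lemma unit_PiE_sets: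
  "finite u \<Longrightarrow> (\<Pi>\<^sub>E j\<in>u. {0..1}) \<in> sets (\<Pi>\<^sub>M j\<in>u. lborel :: real measure)"
  by (rule sets_PiM_I_finite) auto

text \<open>Faces of the unit cube have finite measure, so boundedness on the cube turns
  measurability into integrability.\<close>

lemma faces_integrableI:
  assumes f: "f \<in> faces_measurable d" and B: "\<And>t. t \<in> unit_box d \<Longrightarrow> \<bar>f t\<bar> \<le> B"
  shows "f \<in> faces_integrable d"
  unfolding faces_integrable_def set_integrable_def
proof (intro CollectI allI impI)
  fix u :: "nat set" assume u: "u \<subseteq> {1..d}"
  then have fin: "finite u" using finite_subset by blast
  let ?M = "\<Pi>\<^sub>M j\<in>u. lborel :: real measure" and ?Q = "\<Pi>\<^sub>E j\<in>u. {0..1::real}"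
  have Q: "?Q \<in> sets ?M" by (rule unit_PiE_sets[OF fin])
  have "emeasure ?M ?Q = (\<Prod>j\<in>u. emeasure lborel {0..1::real})"
    by (rule lborel_product.emeasure_PiM[OF fin]) auto
  then have fQ: "emeasure ?M ?Q < \<infinity>" by simp
  have meas: "(\<lambda>t. f (extend1 u t)) \<in> borel_measurable ?M"
    using f u by (auto simp: faces_measurable_def)
  show "integrable ?M (\<lambda>t. indicat_real ?Q t *\<^sub>R f (extend1 u t))"
  proof (rule integrableI_bounded_set[OF Q _ fQ, where B = B])
    show "(\<lambda>t. indicat_real ?Q t *\<^sub>R f (extend1 u t)) \<in> borel_measurable ?M"
      using meas Q by measurable
    show "AE t in ?M. t \<in> ?Q \<longrightarrow> norm (indicat_real ?Q t *\<^sub>R f (extend1 u t)) \<le> B"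
      using B[OF extend1_in_unit_box] by auto
  qed auto
qed

lemma faces_integral_add:
  assumes "f \<in> faces_integrable d" "h \<in> faces_integrable d"
  shows "faces_integral g d (\<lambda>t. f t + h t) = faces_integral g d f + faces_integral g d h"
  using assms unfolding faces_integral_def faces_integrable_def
  by (auto simp: sum.distrib[symmetric] distrib_left[symmetric] intro!: sum.cong)

lemma faces_integrable_add:
  assumes "f \<in> faces_integrable d" "h \<in> faces_integrable d"
  shows "(\<lambda>t. f t + h t) \<in> faces_integrable d"
  using assms unfolding faces_integrable_def by auto

lemma faces_integrable_sum:
  assumes "finite X" "\<And>x. x \<in> X \<Longrightarrow> f x \<in> faces_integrable d"
  shows "(\<lambda>t. \<Sum>x\<in>X. f x t) \<in> faces_integrable d"
  using assms
  by (induction X) (auto intro!: faces_integrable_add, auto simp: faces_integrable_def set_integrable_def)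

lemma faces_integrable_cmult:
  assumes "f \<in> faces_integrable d"
  shows "(\<lambda>t. c * f t) \<in> faces_integrable d"
  using assms unfolding faces_integrable_def by auto

lemma faces_integral_cmult: "faces_integral g d (\<lambda>t. c * f t) = c * faces_integral g d f"
  unfolding faces_integral_def by (simp add: sum_distrib_left mult_ac)

lemma faces_integral_sum:
  assumes "finite X" "\<And>x. x \<in> X \<Longrightarrow> f x \<in> faces_integrable d"
  shows "faces_integral g d (\<lambda>t. \<Sum>x\<in>X. f x t) = (\<Sum>x\<in>X. faces_integral g d (f x))"
  using assms
proof (induction X)
  case empty
  then show ?case by (simp add: faces_integral_def)
next
  case (insert x X)
  then have "faces_integral g d (\<lambda>t. f x t + (\<Sum>x\<in>X. f x t)) =
      faces_integral g d (f x) + faces_integral g d (\<lambda>t. \<Sum>x\<in>X. f x t)"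
    by (intro faces_integral_add faces_integrable_sum) auto
  with insert show ?case by simp
qed

lemma faces_integral_mono:
  assumes "f \<in> faces_integrable d" "h \<in> faces_integrable d"
    and g: "\<And>j. j \<in> {1..d} \<Longrightarrow> g j \<ge> 0"
    and le: "\<And>t. t \<in> unit_box d \<Longrightarrow> f t \<le> h t"
  shows "faces_integral g d f \<le> faces_integral g d h"
  unfolding faces_integral_def
proof (rule sum_mono)
  fix u assume u: "u \<in> Pow {1..d}"
  show "(\<Prod>j\<in>u. g j) * (LINT t : (\<Pi>\<^sub>E j\<in>u. {0..1}) | (\<Pi>\<^sub>M j\<in>u. lborel). f (extend1 u t))
     \<le> (\<Prod>j\<in>u. g j) * (LINT t : (\<Pi>\<^sub>E j\<in>u. {0..1}) | (\<Pi>\<^sub>M j\<in>u. lborel). h (extend1 u t))"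
  proof (rule mult_left_mono[OF set_integral_mono])
    show "0 \<le> prod g u" using u g by (auto intro!: prod_nonneg)
  qed (use assms u extend1_in_unit_box in \<open>auto simp: faces_integrable_def\<close>)
qed

lemma prod_extend1:
  fixes h :: "real \<Rightarrow> real"
  assumes "u \<subseteq> {1..d}" "h 1 = 1"
  shows "(\<Prod>j\<in>{1..d}. h (extend1 u t j)) = (\<Prod>j\<in>u. h (t j))"
proof -
  have "(\<Prod>j\<in>u. h (t j)) = (\<Prod>j\<in>{1..d}. if j \<in> u then h (t j) else 1)"
    using assms(1) by (simp add: prod.If_cases Int_absorb1)
  also have "\<dots> = (\<Prod>j\<in>{1..d}. h (extend1 u t j))"
    using assms(2) by (intro prod.cong) (auto simp: extend1_def)
  finally show ?thesis by simp
qed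

text \<open>On the face \<open>u\<close> the padded coordinates contribute \<open>h 1 = 1\<close>,
  and Fubini gives \<open>c ^ card u\<close>. The sum over all \<open>u\<close> is then the
  expansion of the product of the \<open>1 + g j * c\<close> over subsets.\<close>

lemma faces_integral_prod:
  fixes h :: "real \<Rightarrow> real"
  assumes h: "set_integrable lborel {0..1} h" "h 1 = 1" "(LINT x : {0..1} | lborel. h x) = c"
  shows "faces_integral g d (\<lambda>t. \<Prod>j\<in>{1..d}. h (t j)) = (\<Prod>j\<in>{1..d}. 1 + g j * c)"
proof -
  have "(LINT t : (\<Pi>\<^sub>E j\<in>u. {0..1}) | (\<Pi>\<^sub>M j\<in>u. lborel). \<Prod>j\<in>{1..d}. h (extend1 u t j)) = c ^ card u"
    if u: "u \<subseteq> {1..d}" for u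
  proof -
    have fin: "finite u" using u finite_subset by blast
    have "(LINT t : (\<Pi>\<^sub>E j\<in>u. {0..1}) | (\<Pi>\<^sub>M j\<in>u. lborel). \<Prod>j\<in>{1..d}. h (extend1 u t j)) =
       (\<integral>t. (\<Prod>j\<in>u. indicat_real {0..1} (t j) * h (t j)) \<partial>(\<Pi>\<^sub>M j\<in>u. lborel))"
      unfolding set_lebesgue_integral_def
    proof (rule Bochner_Integration.integral_cong[OF refl])
      fix t assume "t \<in> space (\<Pi>\<^sub>M j\<in>u. lborel :: real measure)"
      \<comment> \<open>Membership in \<open>PiE\<close> includes extensionality, which the points
        of the product space have; for them the indicator factorises.\<close>
      then have "t \<in> extensional u" by (auto simp: space_PiM PiE_iff)
      then have "indicat_real (\<Pi>\<^sub>E j\<in>u. {0..1}) t = (\<Prod>j\<in>u. indicat_real {0..1} (t j))"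
        using fin by (auto simp: PiE_iff indicator_def prod_eq_1_iff split: if_splits)
      then show "indicat_real (\<Pi>\<^sub>E j\<in>u. {0..1}) t *\<^sub>R (\<Prod>j\<in>{1..d}. h (extend1 u t j)) =
        (\<Prod>j\<in>u. indicat_real {0..1} (t j) * h (t j))"
        using prod_extend1[where h = h, OF u h(2)] by (simp add: prod.distrib)
    qed
    also have "\<dots> = (\<Prod>j\<in>u. \<integral>x. indicat_real {0..1} x * h x \<partial>lborel)"
      using h(1) by (intro lborel_product.product_integral_prod[OF fin]) (simp add: set_integrable_def)
    also have "\<dots> = c ^ card u" using h(3) by (simp add: set_lebesgue_integral_def)
    finally show ?thesis .
  qed
  then have "faces_integral g d (\<lambda>t. \<Prod>j\<in>{1..d}. h (t j)) =
      (\<Sum>u\<in>Pow {1..d}. \<Prod>j\<in>u. g j * c)"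
    unfolding faces_integral_def by (intro sum.cong) (auto simp: prod.distrib)
  also have "\<dots> = (\<Prod>j\<in>{1..d}. 1 + g j * c)"
    using prod_add[of "{1..d}" "\<lambda>j. g j * c" "\<lambda>_. 1"] by (simp add: add.commute)
  finally show ?thesis .
qed

lemma set_integral_powr_unit:
  assumes "p > 0"
  shows "set_integrable lborel {0..1} (\<lambda>x::real. x powr p)"
    "(LINT x : {0..1} | lborel. x powr p) = 1 / (p + 1)"
proof -
  show *: "set_integrable lborel {0..1} (\<lambda>x::real. x powr p)"
    using assms by (intro borel_integrable_atLeastAtMost' continuous_on_powr') auto
  have "((\<lambda>x. x powr p) has_integral 1 / (p + 1)) {0..1}"
    using has_integral_powr_from_0[of p 1] assms by simp
  then show "(LINT x : {0..1} | lborel. x powr p) = 1 / (p + 1)"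
    using set_borel_integral_eq_integral(2)[OF *] by (simp add: integral_unique)
qed

text \<open>This is not simply the power formula at exponent \<open>0\<close>: since
  \<open>0 powr 0 = 0\<close>, that power of the volume is not constantly \<open>1\<close>.\<close>

lemma faces_integral_one: "faces_integral g d (\<lambda>_. 1) = (\<Prod>j\<in>{1..d}. 1 + g j)"
proof -
  have "set_integrable lborel {0..1} (\<lambda>_::real. 1::real)"
    using borel_integrable_atLeastAtMost'[of 0 1 "\<lambda>_::real. 1::real"] by simp
  moreover have "(LINT x : {0..1::real} | lborel. 1::real) = 1"
    by (simp add: set_lebesgue_integral_def)
  ultimately show ?thesis
    using faces_integral_prod[of "\<lambda>_. 1" 1 g d] by simp
qed

text \<open>The exponent \<open>p\<close> yields the \<open>p\<close>-th power of the initial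
  discrepancy; \<open>p\<close> and \<open>p + 1\<close> together yield the two products of the
  lower bound.\<close>

lemma faces_integral_prod_powr:
  assumes "p > 0"
  shows "faces_integral g d (\<lambda>t. (\<Prod>j\<in>{1..d}. t j) powr p) = (\<Prod>j\<in>{1..d}. 1 + g j / (p + 1))"
  unfolding prod_powr_distrib using set_integral_powr_unit[OF assms]
  by (subst faces_integral_prod[where c = "1 / (p + 1)"]) auto

section \<open>Local discrepancy as a sum over the points\<close>

definition anchored_box_indicator :: "nat \<Rightarrow> (nat \<Rightarrow> real) \<Rightarrow> (nat \<Rightarrow> real) \<Rightarrow> real" where
  "anchored_box_indicator d x t = (\<Prod>j\<in>{1..d}. of_bool (x j < t j))"

text \<open>\<open>N\<close> times the local discrepancy of an \<open>N\<close>-point set. Without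
  the division, a new point just adds one summand, as the greedy construction requires.\<close>

definition disc_sum :: "nat \<Rightarrow> (nat \<Rightarrow> real) set \<Rightarrow> (nat \<Rightarrow> real) \<Rightarrow> real" where
  "disc_sum d P t = (\<Sum>x\<in>P. anchored_box_indicator d x t - (\<Prod>j\<in>{1..d}. t j))"

lemma anchored_box_indicator_eq:
  "anchored_box_indicator d x t = of_bool (\<forall>j\<in>{1..d}. x j < t j)"
  unfolding anchored_box_indicator_def by (auto simp: prod_eq_1_iff)

lemma anchored_box_indicator_bounds:
  "0 \<le> anchored_box_indicator d x t" "anchored_box_indicator d x t \<le> 1"
  unfolding anchored_box_indicator_eq by (rule zero_less_eq_of_bool, rule of_bool_less_eq_one)

lemma unit_box_prod_bounds:
  assumes "t \<in> unit_box d"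
  shows "0 \<le> (\<Prod>j\<in>{1..d}. t j)" "(\<Prod>j\<in>{1..d}. t j) \<le> 1"
  using assms by (auto simp: unit_box_def intro!: prod_nonneg prod_le_1)

text \<open>Points of \<open>point_sets\<close> have nonnegative coordinates, so the lower end of
  \<open>{0..<t j}\<close> imposes nothing and counting becomes summing indicators.\<close>

lemma local_disc_eq:
  assumes P: "P \<in> point_sets N d" and N: "N \<ge> 1"
  shows "local_disc d P t = disc_sum d P t / real N"
proof -
  have fin: "finite P" and card: "card P = N" and nn: "\<And>x j. x \<in> P \<Longrightarrow> j \<in> {1..d} \<Longrightarrow> 0 \<le> x j"
    using P by (auto simp: point_sets_def PiE_iff)
  have "(\<Sum>x\<in>P. anchored_box_indicator d x t) = (\<Sum>x\<in>P. if \<forall>j\<in>{1..d}. x j \<in> {0..<t j} then 1 else 0)"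
    using nn by (intro sum.cong) (auto simp: anchored_box_indicator_eq)
  also have "\<dots> = real (card {x\<in>P. \<forall>j\<in>{1..d}. x j \<in> {0..<t j}})"
    by (simp only: sum.inter_filter[OF fin, symmetric] sum_constant mult_1_right)
  finally have "(\<Sum>x\<in>P. anchored_box_indicator d x t) =
      real (card {x\<in>P. \<forall>j\<in>{1..d}. x j \<in> {0..<t j}})" .
  then have "disc_sum d P t =
      real (card {x\<in>P. \<forall>j\<in>{1..d}. x j \<in> {0..<t j}}) - real N * (\<Prod>j\<in>{1..d}. t j)"
    unfolding disc_sum_def using card by (simp add: sum_subtractf)
  then show ?thesis
    using N card by (simp add: local_disc_def diff_divide_distrib)
qed

lemma extend1_measurable [measurable]:
  assumes "u \<subseteq> {1..d}"
  shows "(\<lambda>t. extend1 u t j) \<in> borel_measurable (\<Pi>\<^sub>M j\<in>u. lborel)"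
proof (cases "j \<in> u")
  case True
  then have "(\<lambda>t. t j) \<in> measurable (\<Pi>\<^sub>M j\<in>u. lborel :: real measure) lborel"
    by (rule measurable_component_singleton)
  with True show ?thesis by (simp add: extend1_def)
qed (simp add: extend1_def)

lemma faces_measurable_compose:
  assumes "f \<in> faces_measurable d" "h \<in> borel_measurable borel"
  shows "(\<lambda>t. h (f t)) \<in> faces_measurable d"
  using measurable_compose[OF _ assms(2)] assms(1) unfolding faces_measurable_def by blast

lemma faces_measurable_prod: "(\<lambda>t. \<Prod>j\<in>{1..d}. t j) \<in> faces_measurable d"
  unfolding faces_measurable_def by (auto intro!: borel_measurable_prod extend1_measurable)

lemma faces_measurable_indicator: "anchored_box_indicator d x \<in> faces_measurable d"
  unfolding faces_measurable_def
proof (intro CollectI allI impI)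
  fix u assume "u \<subseteq> {1..d}"
  note [measurable] = extend1_measurable[OF this]
  show "(\<lambda>t. anchored_box_indicator d x (extend1 u t)) \<in> borel_measurable (\<Pi>\<^sub>M j\<in>u. lborel)"
    unfolding anchored_box_indicator_def by measurable
qed

lemma faces_measurable_disc_sum: "disc_sum d P \<in> faces_measurable d"
  using faces_measurable_prod faces_measurable_indicator
  unfolding disc_sum_def faces_measurable_def
  by (auto intro!: borel_measurable_sum borel_measurable_diff)

lemma disc_sum_bound:
  assumes "t \<in> unit_box d" 
  shows "\<bar>disc_sum d P t\<bar> \<le> card P"
proof -
  have "\<bar>disc_sum d P t\<bar> \<le> (\<Sum>x\<in>P. \<bar>anchored_box_indicator d x t - (\<Prod>j\<in>{1..d}. t j)\<bar>)"
    unfolding disc_sum_def by (rule sum_abs)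
  also have "\<dots> \<le> (\<Sum>x\<in>P. 1)"
  proof (rule sum_mono)
    fix x
    show "\<bar>anchored_box_indicator d x t - (\<Prod>j\<in>{1..d}. t j)\<bar> \<le> 1"
      using anchored_box_indicator_bounds[of d x t] unit_box_prod_bounds[OF assms] by linarith
  qed
  finally show ?thesis by simp
qed

lemma disc_sum_square_integrable: "(\<lambda>t. (disc_sum d P t)\<^sup>2) \<in> faces_integrable d"
proof (rule faces_integrableI)
  show "(\<lambda>t. (disc_sum d P t)\<^sup>2) \<in> faces_measurable d"
    by (rule faces_measurable_compose[OF faces_measurable_disc_sum]) measurable
  show "\<bar>(disc_sum d P t)\<^sup>2\<bar> \<le> (real (card P))\<^sup>2" if "t \<in> unit_box d" for t
    using disc_sum_bound[OF that, of P] by (simp add: power2_le_iff_abs_le)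
qed

lemma const_faces_integrable: "(\<lambda>_. c) \<in> faces_integrable d"
  by (rule faces_integrableI[where B = "\<bar>c\<bar>"]) (auto simp: faces_measurable_def)

lemma prod_powr_integrable:
  assumes "p > 0"
  shows "(\<lambda>t. (\<Prod>j\<in>{1..d}. t j) powr p) \<in> faces_integrable d"
proof (rule faces_integrableI)
  show "(\<lambda>t. (\<Prod>j\<in>{1..d}. t j) powr p) \<in> faces_measurable d"
    by (rule faces_measurable_compose[OF faces_measurable_prod]) measurable
  show "\<bar>(\<Prod>j\<in>{1..d}. t j) powr p\<bar> \<le> 1" if "t \<in> unit_box d" for t
    using unit_box_prod_bounds[OF that] assms by (simp add: powr_le1)
qed

lemma disc_power_integrable:
  assumes "p > 0"
  shows "(\<lambda>t. \<bar>disc_sum d P t / real N\<bar> powr p) \<in> faces_integrable d"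
proof (rule faces_integrableI)
  show "(\<lambda>t. \<bar>disc_sum d P t / real N\<bar> powr p) \<in> faces_measurable d"
    by (rule faces_measurable_compose[OF faces_measurable_disc_sum]) measurable
  show "\<bar>\<bar>disc_sum d P t / real N\<bar> powr p\<bar> \<le> (card P / real N) powr p" if "t \<in> unit_box d" for t
    using disc_sum_bound[OF that, of P] assms by (auto intro!: powr_mono2 divide_right_mono)
qed

text \<open>The weighted discrepancy omits the face \<open>u = {}\<close>.\<close>

lemma weighted_Lp_disc_powr:
  assumes P: "P \<in> point_sets N d" and N: "N \<ge> 1" and p: "p > 0"
    and nn: "\<And>j. j \<in> {1..d} \<Longrightarrow> \<gamma> j \<ge> 0"
  shows "weighted_Lp_disc p \<gamma> d P powr p =
      faces_integral (\<lambda>j. \<gamma> j powr (p / 2)) d (\<lambda>t. \<bar>disc_sum d P t / real N\<bar> powr p)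
      - \<bar>disc_sum d P (\<lambda>_. 1) / real N\<bar> powr p"
proof -
  define F where "F u = (\<Prod>j\<in>u. \<gamma> j powr (p / 2)) *
        (LINT t : (\<Pi>\<^sub>E j\<in>u. {0..1}) | (\<Pi>\<^sub>M j\<in>u. lborel). \<bar>disc_sum d P (extend1 u t) / real N\<bar> powr p)"
    for u :: "nat set"
  have F_nonneg: "F u \<ge> 0" for u
    unfolding F_def set_lebesgue_integral_def
    by (intro mult_nonneg_nonneg prod_nonneg Bochner_Integration.integral_nonneg) auto
  have "weighted_Lp_disc p \<gamma> d P = (\<Sum>u\<in>Pow {1..d} - {{}}. F u) powr (1 / p)"
    unfolding weighted_Lp_disc_def local_disc_eq[OF P N] F_def prod_powr_distrib extend1_def ..
  then have "weighted_Lp_disc p \<gamma> d P powr p = (\<Sum>u\<in>Pow {1..d} - {{}}. F u)"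
    using p F_nonneg by (simp add: powr_powr sum_nonneg)
  also have "\<dots> = (\<Sum>u\<in>Pow {1..d}. F u) - F {}"
    by (subst sum_diff1) auto
  \<comment> \<open>The product measure over the empty index set is a unit point mass, and its only
    point extends to the all-ones point.\<close>
  also have "F {} = \<bar>disc_sum d P (\<lambda>_. 1) / real N\<bar> powr p"
    by (simp add: F_def PiM_empty set_lebesgue_integral_def lebesgue_integral_count_space_finite extend1_def)
  finally show ?thesis unfolding F_def faces_integral_def .
qed

section \<open>Lower bound for the discrepancy of \<open>N\<close> points\<close>

lemma weighted_Lp_disc_nonneg: "0 \<le> weighted_Lp_disc p \<gamma> d P"
  by (simp add: weighted_Lp_disc_def)

text \<open>Coordinates are strictly below \<open>1\<close>, so the box at the all-ones point has
  volume \<open>1\<close> and contains every point. Hence the omitted face contributes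
  nothing.\<close>

lemma disc_sum_at_one:
  assumes "P \<in> point_sets N d"
  shows "disc_sum d P (\<lambda>_. 1) = 0"
  using assms by (auto simp: disc_sum_def anchored_box_indicator_eq point_sets_def PiE_iff subset_iff intro!: sum.neutral)

text \<open>The empirical measure of an anchored box is \<open>0\<close> or at least \<open>1 / N\<close>. Hence boxes of
  volume below \<open>1 / (2 N)\<close> have local discrepancy at least their volume, and all other boxes
  make the left-hand side nonpositive.\<close>

lemma disc_power_lower:
  assumes P: "P \<in> point_sets N d" and N: "N \<ge> 1" and p: "p > 0" and t: "t \<in> unit_box d"
  shows "(\<Prod>j\<in>{1..d}. t j) powr p - 2 * real N * (\<Prod>j\<in>{1..d}. t j) powr (p + 1)
      \<le> \<bar>disc_sum d P t / real N\<bar> powr p"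
proof -
  define V where "V = (\<Prod>j\<in>{1..d}. t j)"
  define k where "k = card {x\<in>P. \<forall>j\<in>{1..d}. x j \<in> {0..<t j}}"
  have V: "0 \<le> V" "V \<le> 1" unfolding V_def using unit_box_prod_bounds[OF t] .
  have D: "disc_sum d P t / real N = real k / real N - V"
    using local_disc_eq[OF P N, of t] P by (simp add: local_disc_def k_def V_def point_sets_def)
  \<comment> \<open>The sign of the factor \<open>1 - 2 * real N * V\<close> separates the two
    cases.\<close>
  have eq: "V powr p - 2 * real N * V powr (p + 1) = V powr p * (1 - 2 * real N * V)"
    using V by (cases "V = 0") (auto simp: powr_add algebra_simps)
  show ?thesis
  proof (cases "2 * real N * V \<le> 1")
    case True
    have "V \<le> \<bar>real k / real N - V\<bar>"
    proof (cases "k = 0")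
      case False
      then have "1 / real N \<le> real k / real N" by (intro divide_right_mono) auto
      moreover have "2 * V \<le> 1 / real N" using True N by (simp add: field_simps)
      ultimately show ?thesis by linarith
    qed (use V in auto)
    then have "V powr p \<le> \<bar>real k / real N - V\<bar> powr p"
      using V p by (intro powr_mono2) auto
    moreover have "V powr p * (1 - 2 * real N * V) \<le> V powr p"
      using V by (intro mult_left_le) auto
    ultimately show ?thesis using eq D by (simp add: V_def)
  next
    case False
    then have "V powr p * (1 - 2 * real N * V) \<le> 0" by (intro mult_nonneg_nonpos) auto
    also have "0 \<le> \<bar>disc_sum d P t / real N\<bar> powr p" by simp
    finally show ?thesis using eq by (simp add: V_def)
  qed
qed

text \<open>Apply \<open>J\<close> to the pointwise bound: both powers of the volume integrate to
  products, and the omitted face has value \<open>0\<close>.\<close>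

lemma weighted_Lp_disc_lower:
  assumes P: "P \<in> point_sets N d" and N: "N \<ge> 1" and p: "p > 0"
    and nn: "\<And>j. j \<in> {1..d} \<Longrightarrow> \<gamma> j \<ge> 0"
  shows "(\<Prod>j\<in>{1..d}. 1 + \<gamma> j powr (p / 2) / (p + 1))
      - 2 * real N * (\<Prod>j\<in>{1..d}. 1 + \<gamma> j powr (p / 2) / (p + 2))
      \<le> weighted_Lp_disc p \<gamma> d P powr p"
proof -
  let ?V = "\<lambda>t. \<Prod>j\<in>{1..d}. t j :: real" and ?J = "faces_integral (\<lambda>j. \<gamma> j powr (p / 2)) d"
  have i1: "(\<lambda>t. ?V t powr p) \<in> faces_integrable d"
    and i2: "(\<lambda>t. - (2 * real N) * ?V t powr (p + 1)) \<in> faces_integrable d"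
    using p by (intro prod_powr_integrable faces_integrable_cmult; simp)+
  have "?J (\<lambda>t. ?V t powr p + - (2 * real N) * ?V t powr (p + 1))
      = ?J (\<lambda>t. ?V t powr p) - 2 * real N * ?J (\<lambda>t. ?V t powr (p + 1))"
    unfolding faces_integral_add[OF i1 i2] faces_integral_cmult by simp
  also have "?J (\<lambda>t. ?V t powr p) = (\<Prod>j\<in>{1..d}. 1 + \<gamma> j powr (p / 2) / (p + 1))"
    using p by (rule faces_integral_prod_powr)
  also have "?J (\<lambda>t. ?V t powr (p + 1)) = (\<Prod>j\<in>{1..d}. 1 + \<gamma> j powr (p / 2) / (p + 2))"
    using p by (subst faces_integral_prod_powr) (auto simp: add.assoc)
  finally have eq: "?J (\<lambda>t. ?V t powr p + - (2 * real N) * ?V t powr (p + 1)) =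
      (\<Prod>j\<in>{1..d}. 1 + \<gamma> j powr (p / 2) / (p + 1))
      - 2 * real N * (\<Prod>j\<in>{1..d}. 1 + \<gamma> j powr (p / 2) / (p + 2))" .
  have "?J (\<lambda>t. ?V t powr p + - (2 * real N) * ?V t powr (p + 1))
      \<le> ?J (\<lambda>t. \<bar>disc_sum d P t / real N\<bar> powr p)"
    using disc_power_lower[OF P N p]
    by (intro faces_integral_mono disc_power_integrable faces_integrable_add i1 i2) (use p in auto)
  then show ?thesis
    using weighted_Lp_disc_powr[OF P N p nn] disc_sum_at_one[OF P] p eq by simp
qed

section \<open>Upper bound: equidistant grids and a greedy choice of points\<close>

lemma card_shifted_grid:
  fixes t s :: real
  assumes m: "m \<ge> 1" and s: "0 \<le> s" "s < 1" and t: "0 \<le> t" "t \<le> 1"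
  shows "\<bar>real (card {i. i < m \<and> (real i + s) / real m < t}) / real m - t\<bar> \<le> 1 / real m"
proof -
  \<comment> \<open>The indices with \<open>real i < real m * t - s\<close> are those below this
    ceiling, and \<open>0 \<le> s < 1\<close> keeps it within \<open>1\<close> of
    \<open>real m * t\<close>.\<close>
  let ?n = "nat \<lceil>real m * t - s\<rceil>"
  have "real m * t \<le> real m" using t by (simp add: mult_left_le)
  then have n: "?n \<le> m" using s by linarith
  have "{i. i < m \<and> (real i + s) / real m < t} = {i. i < ?n}"
  proof (rule set_eqI)
    fix i
    have "(real i + s) / real m < t \<longleftrightarrow> real i < real m * t - s"
      using m by (simp add: field_simps)
    also have "\<dots> \<longleftrightarrow> i < ?n" by linarith
    finally show "i \<in> {i. i < m \<and> (real i + s) / real m < t} \<longleftrightarrow> i \<in> {i. i < ?n}"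
      using n less_le_trans[of i ?n m] by blast
  qed
  then have "real (card {i. i < m \<and> (real i + s) / real m < t}) = real ?n" by simp
  moreover have "\<bar>real ?n - real m * t\<bar> \<le> 1"
    using s t mult_nonneg_nonneg[of "real m" t] by linarith
  moreover have "real ?n / real m - t = (real ?n - real m * t) / real m"
    using m by (simp add: diff_divide_distrib)
  ultimately show ?thesis using m by (simp add: divide_right_mono)
qed

text \<open>A generic shift keeps the equidistant grid away from the finite set \<open>A\<close>; this makes the
  points produced by the greedy construction below distinct.\<close>

lemma shifted_grid_avoiding:
  fixes A :: "real set"
  assumes m: "m \<ge> 1" and A: "finite A"
  obtains T where "finite T" "card T = m" "T \<subseteq> {0..<1}" "T \<inter> A = {}"
    "\<forall>t\<in>{0..1}. \<bar>real (card {a\<in>T. a < t}) / real m - t\<bar> \<le> 1 / real m"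
proof -
  \<comment> \<open>A shift is bad if some \<open>(real i + s) / real m\<close> equals an
    \<open>a \<in> A\<close>, that is, \<open>s = real m * a - real i\<close>. Only finitely many
    shifts are bad.\<close>
  have "infinite ({0..<1::real} - (\<lambda>(a, i). real m * a - real i) ` (A \<times> {..<m}))"
    using A by (intro Diff_infinite_finite) auto
  then obtain s where s: "s \<in> {0..<1} - (\<lambda>(a, i). real m * a - real i) ` (A \<times> {..<m})"
    by (metis ex_in_conv finite.emptyI)
  define T where "T = (\<lambda>i. (real i + s) / real m) ` {..<m}"
  have inj: "inj_on (\<lambda>i. (real i + s) / real m) X" for X
    using m by (auto simp: inj_on_def)
  have T_sub: "T \<subseteq> {0..<1}"
  proof
    fix a assume "a \<in> T"
    then obtain i where i: "i < m" "a = (real i + s) / real m" by (auto simp: T_def)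
    then have "real i + 1 \<le> real m" by linarith
    moreover have "0 \<le> s" "s < 1" using s by auto
    ultimately have "0 \<le> real i + s" "real i + s < real m" by linarith+
    with i(2) m show "a \<in> {0..<1}" by simp
  qed
  have T_disj: "T \<inter> A = {}"
  proof (rule ccontr)
    assume "T \<inter> A \<noteq> {}"
    then obtain i where i: "i < m" "(real i + s) / real m \<in> A" by (auto simp: T_def)
    have "s = real m * ((real i + s) / real m) - real i" using m by simp
    then have "s = (\<lambda>(a, i). real m * a - real i) ((real i + s) / real m, i)"
      by (simp only: prod.case)
    moreover have "((real i + s) / real m, i) \<in> A \<times> {..<m}" using i by simp
    ultimately have "s \<in> (\<lambda>(a, i). real m * a - real i) ` (A \<times> {..<m})"
      by (rule image_eqI)
    with s show False by blast
  qed
  have T_approx: "\<bar>real (card {a\<in>T. a < t}) / real m - t\<bar> \<le> 1 / real m" if "t \<in> {0..1}" for t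
  proof -
    have "{a\<in>T. a < t} = (\<lambda>i. (real i + s) / real m) ` {i. i < m \<and> (real i + s) / real m < t}"
      by (auto simp: T_def)
    then have "card {a\<in>T. a < t} = card {i. i < m \<and> (real i + s) / real m < t}"
      using inj by (simp add: card_image)
    then show ?thesis using card_shifted_grid[OF m, of s t] s that by simp
  qed
  show thesis
    by (rule that[OF _ _ T_sub T_disj]) (simp_all add: T_def card_image[OF inj] T_approx[unfolded T_def])
qed

text \<open>The number of grid points in a box factorises over the coordinates. Two products of
  factors bounded by \<open>1\<close> differ by at most the sum of the differences of their factors,
  here \<open>d\<close> times \<open>1 / m\<close>.\<close>

lemma grid_discrepancy_bound:
  assumes T: "finite T" "card T = m" "m \<ge> 1"
    "\<forall>s\<in>{0..1}. \<bar>real (card {a\<in>T. a < s}) / real m - s\<bar> \<le> 1 / real m"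
    and t: "t \<in> unit_box d"
  shows "\<bar>disc_sum d (\<Pi>\<^sub>E j\<in>{1..d}. T) t\<bar> \<le> real (m ^ d) * (real d / real m)"
proof -
  define c where "c s = real (card {a\<in>T. a < s}) / real m" for s
  have sum_T: "(\<Sum>a\<in>T. of_bool (a < s)) = real m * c s" for s
    using T by (simp add: c_def sum.If_cases of_bool_def Int_def)
  have "(\<Sum>x\<in>(\<Pi>\<^sub>E j\<in>{1..d}. T). anchored_box_indicator d x t) = (\<Prod>j\<in>{1..d}. \<Sum>a\<in>T. of_bool (a < t j))"
    unfolding anchored_box_indicator_def using T(1) by (subst prod_sum_PiE) auto
  also have "\<dots> = real m ^ d * (\<Prod>j\<in>{1..d}. c (t j))"
    by (simp add: sum_T prod.distrib)
  finally have "disc_sum d (\<Pi>\<^sub>E j\<in>{1..d}. T) t = real m ^ d * ((\<Prod>j\<in>{1..d}. c (t j)) - (\<Prod>j\<in>{1..d}. t j))"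
    unfolding disc_sum_def by (simp add: sum_subtractf card_PiE T(2) right_diff_distrib)
  also have "\<bar>\<dots>\<bar> = real (m ^ d) * \<bar>(\<Prod>j\<in>{1..d}. c (t j)) - (\<Prod>j\<in>{1..d}. t j)\<bar>"
    by (simp add: abs_mult)
  also have "\<bar>(\<Prod>j\<in>{1..d}. c (t j)) - (\<Prod>j\<in>{1..d}. t j)\<bar> \<le> (\<Sum>j\<in>{1..d}. \<bar>c (t j) - t j\<bar>)"
  proof (rule norm_prod_diff[where 'a = real, unfolded real_norm_def])
    fix j assume "j \<in> {1..d}"
    then show "\<bar>t j\<bar> \<le> 1" using t by (auto simp: unit_box_def)
    have "card {a\<in>T. a < t j} \<le> m" unfolding T(2)[symmetric] using T(1) by (intro card_mono) auto
    then show "\<bar>c (t j)\<bar> \<le> 1" using T(3) by (simp add: c_def)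
  qed
  also have "\<dots> \<le> (\<Sum>j\<in>{1..d}. 1 / real m)"
    using t T(4) by (intro sum_mono) (auto simp: c_def unit_box_def)
  finally show ?thesis by (simp add: mult_left_mono)
qed

text \<open>Averaged over the candidates for the new point, the cross term of the square almost vanishes,
  so some candidate increases the mean square by at most twice the total mass.\<close>

lemma greedy_step:
  assumes P: "P \<in> point_sets k d" and d: "d \<ge> 1"
    and g: "\<And>j. j \<in> {1..d} \<Longrightarrow> g j \<ge> 0"
  obtains P' where "P' \<in> point_sets (Suc k) d"
    "faces_integral g d (\<lambda>t. (disc_sum d P' t)\<^sup>2) \<le>
       faces_integral g d (\<lambda>t. (disc_sum d P t)\<^sup>2) + 2 * (\<Prod>j\<in>{1..d}. 1 + g j)"
proof -
  \<comment> \<open>Chosen so that the cross term, at most \<open>2 * k * card G * d / m\<close>,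
    stays below \<open>card G\<close>. The \<open>1\<close> keeps \<open>m\<close> positive when
    \<open>k = 0\<close>.\<close>
  define m where "m = 2 * k * d + 1"
  have fin: "finite P" and card: "card P = k" and sub: "P \<subseteq> (\<Pi>\<^sub>E j\<in>{1..d}. {0..<1})"
    using P by (auto simp: point_sets_def)
  have "1 \<le> m" "finite ((\<lambda>x. x 1) ` P)" using fin by (simp_all add: m_def)
  \<comment> \<open>Avoiding the first coordinates of \<open>P\<close> already keeps every grid
    point outside \<open>P\<close>, since \<open>d \<ge> 1\<close>.\<close>
  then obtain T where T: "finite T" "card T = m" "T \<subseteq> {0..<1}" "T \<inter> (\<lambda>x. x 1) ` P = {}"
    "\<forall>t\<in>{0..1}. \<bar>real (card {a\<in>T. a < t}) / real m - t\<bar> \<le> 1 / real m"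
    by (rule shifted_grid_avoiding)
  define G where "G = (\<Pi>\<^sub>E j\<in>{1..d}. T)"
  let ?J = "faces_integral g d" and ?W = "\<Prod>j\<in>{1..d}. 1 + g j"
  define f where "f x t = anchored_box_indicator d x t - (\<Prod>j\<in>{1..d}. t j)" for x t
  have G: "finite G" "card G = m ^ d" "G \<noteq> {}"
    using T(1,2) by (auto simp: G_def card_PiE finite_PiE PiE_eq_empty_iff m_def)
  have disj: "x \<notin> P" if "x \<in> G" for x
  proof
    assume "x \<in> P"
    moreover have "x 1 \<in> T" using that d by (auto simp: G_def PiE_iff)
    ultimately show False using T(4) by blast
  qed
  have insert_eq: "disc_sum d (insert x P) t = disc_sum d P t + f x t" if "x \<in> G" for x t
    using disj[OF that] fin by (simp add: disc_sum_def f_def)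
  have pointwise: "(\<Sum>x\<in>G. (disc_sum d (insert x P) t)\<^sup>2) \<le> real (card G) * ((disc_sum d P t)\<^sup>2 + 2)"
    if t: "t \<in> unit_box d" for t
  proof -
    define S where "S = disc_sum d P t"
    have G_sum: "disc_sum d G t = (\<Sum>x\<in>G. f x t)" by (simp add: disc_sum_def f_def)
    have "(\<Sum>x\<in>G. (disc_sum d (insert x P) t)\<^sup>2) = (\<Sum>x\<in>G. S\<^sup>2 + 2 * S * f x t + (f x t)\<^sup>2)"
      by (intro sum.cong refl) (simp add: insert_eq power2_sum S_def)
    also have "\<dots> = real (card G) * S\<^sup>2 + 2 * S * disc_sum d G t + (\<Sum>x\<in>G. (f x t)\<^sup>2)"
      by (simp add: sum.distrib sum_distrib_left G_sum)
    \<comment> \<open>The squares and the cross term each contribute at most \<open>card G\<close>,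
      which explains the summand \<open>2\<close>.\<close>
    also have "(\<Sum>x\<in>G. (f x t)\<^sup>2) \<le> (\<Sum>x\<in>G. 1)"
    proof (rule sum_mono)
      fix x
      have "\<bar>f x t\<bar> \<le> 1"
        using anchored_box_indicator_bounds[of d x t] unit_box_prod_bounds[OF t]
        unfolding f_def by linarith
      then show "(f x t)\<^sup>2 \<le> 1" by (simp add: abs_square_le_1)
    qed
    also have "2 * S * disc_sum d G t \<le> 2 * (\<bar>S\<bar> * \<bar>disc_sum d G t\<bar>)"
      by (simp add: abs_mult[symmetric])
    also have "\<bar>S\<bar> * \<bar>disc_sum d G t\<bar> \<le> real k * (real (card G) * (real d / real m))"
    proof (rule mult_mono)
      show "\<bar>S\<bar> \<le> real k" unfolding S_def using disc_sum_bound[OF t, of P] card by simp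
      show "\<bar>disc_sum d G t\<bar> \<le> real (card G) * (real d / real m)"
        unfolding G(2) unfolding G_def by (rule grid_discrepancy_bound[OF T(1,2) _ T(5) t]) (simp add: m_def)
    qed simp_all
    also have "2 * (real k * (real (card G) * (real d / real m))) =
        real (card G) * (real (2 * k * d) / real m)" by simp
    also have "\<dots> \<le> real (card G) * 1"
    proof (rule mult_left_mono)
      have "0 < real m" "real (2 * k * d) \<le> real m" unfolding m_def by linarith+
      then show "real (2 * k * d) / real m \<le> 1" by (simp only: divide_le_eq_1_pos)
    qed simp
    finally show ?thesis by (simp add: S_def algebra_simps)
  qed
  have "(\<Sum>x\<in>G. ?J (\<lambda>t. (disc_sum d (insert x P) t)\<^sup>2)) = ?J (\<lambda>t. \<Sum>x\<in>G. (disc_sum d (insert x P) t)\<^sup>2)"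
    by (rule faces_integral_sum[symmetric]) (auto simp: G disc_sum_square_integrable)
  also have "\<dots> \<le> ?J (\<lambda>t. real (card G) * ((disc_sum d P t)\<^sup>2 + 2))"
    using G(1) g pointwise
    by (intro faces_integral_mono faces_integrable_sum faces_integrable_cmult faces_integrable_add
        disc_sum_square_integrable const_faces_integrable) auto
  also have "\<dots> = real (card G) * (?J (\<lambda>t. (disc_sum d P t)\<^sup>2) + ?J (\<lambda>_. 2))"
    by (simp only: faces_integral_cmult faces_integral_add[OF disc_sum_square_integrable const_faces_integrable])
  also have "?J (\<lambda>_. 2) = 2 * ?W"
    using faces_integral_cmult[of g d 2 "\<lambda>_. 1"] by (simp add: faces_integral_one)
  finally have "(\<Sum>x\<in>G. ?J (\<lambda>t. (disc_sum d (insert x P) t)\<^sup>2)) \<le>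
      (\<Sum>x\<in>G. ?J (\<lambda>t. (disc_sum d P t)\<^sup>2) + 2 * ?W)" by (simp only: sum_constant)
  \<comment> \<open>Were all candidates above the bound, the two sums over the nonempty set
    \<open>G\<close> would compare strictly the other way.\<close>
  then have "\<exists>x\<in>G. ?J (\<lambda>t. (disc_sum d (insert x P) t)\<^sup>2) \<le> ?J (\<lambda>t. (disc_sum d P t)\<^sup>2) + 2 * ?W"
  proof (rule contrapos_pp)
    assume "\<not> (\<exists>x\<in>G. ?J (\<lambda>t. (disc_sum d (insert x P) t)\<^sup>2) \<le> ?J (\<lambda>t. (disc_sum d P t)\<^sup>2) + 2 * ?W)"
    then show "\<not> (\<Sum>x\<in>G. ?J (\<lambda>t. (disc_sum d (insert x P) t)\<^sup>2)) \<le>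
      (\<Sum>x\<in>G. ?J (\<lambda>t. (disc_sum d P t)\<^sup>2) + 2 * ?W)"
      unfolding not_le by (intro sum_strict_mono[OF G(1,3)]) (simp add: not_le)
  qed
  then obtain x where x: "x \<in> G"
    "?J (\<lambda>t. (disc_sum d (insert x P) t)\<^sup>2) \<le> ?J (\<lambda>t. (disc_sum d P t)\<^sup>2) + 2 * ?W"
    by (rule bexE)
  have "insert x P \<in> point_sets (Suc k) d"
  proof -
    have "x \<in> (\<Pi>\<^sub>E j\<in>{1..d}. {0..<1})"
      using x(1) PiE_mono[of "{1..d}" "\<lambda>_. T" "\<lambda>_. {0..<1}"] T(3) unfolding G_def by blast
    then show ?thesis using sub fin card disj[OF x(1)] by (simp add: point_sets_def)
  qed
  with x(2) show thesis by (rule that[rotated])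
qed

text \<open>Starting from the empty set, whose square integral is \<open>0\<close>, each greedy step
  adds at most twice \<open>J 1\<close>.\<close>

lemma ex_point_set_small_square:
  assumes d: "d \<ge> 1" and g: "\<And>j. j \<in> {1..d} \<Longrightarrow> g j \<ge> 0"
  shows "\<exists>P\<in>point_sets N d. faces_integral g d (\<lambda>t. (disc_sum d P t)\<^sup>2) \<le> 2 * real N * (\<Prod>j\<in>{1..d}. 1 + g j)"
proof (induction N)
  case 0
  have "{} \<in> point_sets 0 d" by (simp add: point_sets_def)
  moreover have "faces_integral g d (\<lambda>t. (disc_sum d {} t)\<^sup>2) = 0"
    by (simp add: disc_sum_def faces_integral_def)
  ultimately show ?case by force
next
  case (Suc N)
  then obtain P where P: "P \<in> point_sets N d"
    "faces_integral g d (\<lambda>t. (disc_sum d P t)\<^sup>2) \<le> 2 * real N * (\<Prod>j\<in>{1..d}. 1 + g j)" by blast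
  obtain P' where P': "P' \<in> point_sets (Suc N) d"
    "faces_integral g d (\<lambda>t. (disc_sum d P' t)\<^sup>2) \<le>
       faces_integral g d (\<lambda>t. (disc_sum d P t)\<^sup>2) + 2 * (\<Prod>j\<in>{1..d}. 1 + g j)"
    by (rule greedy_step[where g = g, OF P(1) d g])
  then show ?case using P(2) by (intro bexI[OF _ P'(1)]) (simp add: algebra_simps)
qed

text \<open>The passage from the mean square to the mean absolute value uses a pointwise
  arithmetic-geometric mean inequality in place of Cauchy-Schwarz, so linearity and monotonicity of
  \<open>J\<close> suffice.\<close>

lemma ex_point_set_small_disc:
  assumes d: "d \<ge> 1" and N: "N \<ge> 1" and p: "p \<ge> 1"
    and nn: "\<And>j. j \<in> {1..d} \<Longrightarrow> \<gamma> j \<ge> 0"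
  shows "\<exists>P\<in>point_sets N d. weighted_Lp_disc p \<gamma> d P powr p
    \<le> 2 * (\<Prod>j\<in>{1..d}. 1 + \<gamma> j powr (p / 2)) / sqrt (real N)"
proof -
  let ?J = "faces_integral (\<lambda>j. \<gamma> j powr (p / 2)) d" and ?W = "\<Prod>j\<in>{1..d}. 1 + \<gamma> j powr (p / 2)"
  obtain P where P: "P \<in> point_sets N d" "?J (\<lambda>t. (disc_sum d P t)\<^sup>2) \<le> 2 * real N * ?W"
    using ex_point_set_small_square[OF d, of "\<lambda>j. \<gamma> j powr (p / 2)" N] by auto
  \<comment> \<open>The mean square of the discrepancy is of order \<open>1 / N\<close>; this
    \<open>r\<close> makes both terms of \<open>am_gm\<close> of order
    \<open>1 / sqrt N\<close>.\<close>
  define r where "r = sqrt (real N)"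
  have r: "r > 0" "r\<^sup>2 = real N" using N by (auto simp: r_def)
  have W: "?W \<ge> 0" by (intro prod_nonneg) (simp add: add_nonneg_nonneg)
  have i: "(\<lambda>t. (r / (2 * (real N)\<^sup>2)) * (disc_sum d P t)\<^sup>2) \<in> faces_integrable d"
    "(\<lambda>t. (1 / (2 * r)) * 1) \<in> faces_integrable d"
    by (intro faces_integrable_cmult disc_sum_square_integrable const_faces_integrable)+
  have am_gm: "x \<le> (r * x\<^sup>2 + 1 / r) / 2" for x
  proof -
    have "0 \<le> (r * x - 1)\<^sup>2 / r" using r by simp
    also have "(r * x - 1)\<^sup>2 / r = r * x\<^sup>2 - 2 * x + 1 / r"
      using r(1) by (simp add: power2_diff field_simps power2_eq_square)
    finally show ?thesis by simp
  qed
  have pointwise: "\<bar>disc_sum d P t / real N\<bar> powr p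
      \<le> r / (2 * (real N)\<^sup>2) * (disc_sum d P t)\<^sup>2 + 1 / (2 * r) * 1" if t: "t \<in> unit_box d" for t
  proof -
    let ?D = "\<bar>disc_sum d P t / real N\<bar>"
    have D: "0 \<le> ?D" "?D \<le> 1"
      using disc_sum_bound[OF t, of P] P(1) N by (auto simp: point_sets_def)
    then have "?D powr p \<le> ?D powr 1" using p by (intro powr_mono') auto
    also have "?D powr 1 = ?D" using D by simp
    also have "?D \<le> (r * ?D\<^sup>2 + 1 / r) / 2"
      by (rule am_gm)
    also have "\<dots> = r / (2 * (real N)\<^sup>2) * (disc_sum d P t)\<^sup>2 + 1 / (2 * r) * 1"
      by (simp add: power_divide field_simps)
    finally show ?thesis .
  qed
  \<comment> \<open>Adding the face \<open>{}\<close> can only increase the value.\<close>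
  have "weighted_Lp_disc p \<gamma> d P powr p \<le> ?J (\<lambda>t. \<bar>disc_sum d P t / real N\<bar> powr p)"
    using weighted_Lp_disc_powr[OF P(1) N _ nn] p by simp
  also have "\<dots> \<le> ?J (\<lambda>t. r / (2 * (real N)\<^sup>2) * (disc_sum d P t)\<^sup>2 + 1 / (2 * r) * 1)"
    using p pointwise by (intro faces_integral_mono disc_power_integrable faces_integrable_add i) auto
  also have "\<dots> = r / (2 * (real N)\<^sup>2) * ?J (\<lambda>t. (disc_sum d P t)\<^sup>2) + 1 / (2 * r) * ?W"
    unfolding faces_integral_add[OF i] faces_integral_cmult faces_integral_one ..
  also have "\<dots> \<le> r / (2 * (real N)\<^sup>2) * (2 * real N * ?W) + 1 / (2 * r) * ?W"
    using P(2) r by (intro add_right_mono mult_left_mono) auto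
  also have "\<dots> = (3 / 2) * ?W / r"
    using r(1) unfolding r(2)[symmetric] by (simp add: field_simps power2_eq_square)
  \<comment> \<open>The constant \<open>3 / 2\<close> is rounded up.\<close>
  also have "\<dots> \<le> 2 * ?W / r"
    using W r by (intro divide_right_mono mult_right_mono) auto
  finally show ?thesis using P(1) by (auto simp: r_def)
qed

section \<open>Minimal discrepancy and two-sided bounds on its inverse\<close>

lemma point_sets_nonempty: "d \<ge> 1 \<Longrightarrow> point_sets N d \<noteq> {}"
  using ex_point_set_small_square[of d "\<lambda>_. 0" N] by auto

lemma min_disc_le:
  "P \<in> point_sets N d \<Longrightarrow> min_disc p \<gamma> N d \<le> weighted_Lp_disc p \<gamma> d P"
  unfolding min_disc_def
  by (rule cINF_lower) (auto intro!: bdd_belowI2[where m = 0] weighted_Lp_disc_nonneg)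

text \<open>A positive lower bound passes to the infimum after taking \<open>p\<close>-th roots; a
  nonpositive one is trivial.\<close>

lemma min_disc_lower:
  assumes d: "d \<ge> 1" and N: "N \<ge> 1" and p: "p > 0"
    and nn: "\<And>j. j \<in> {1..d} \<Longrightarrow> \<gamma> j \<ge> 0"
  shows "(\<Prod>j\<in>{1..d}. 1 + \<gamma> j powr (p / 2) / (p + 1))
      - 2 * real N * (\<Prod>j\<in>{1..d}. 1 + \<gamma> j powr (p / 2) / (p + 2))
      \<le> min_disc p \<gamma> N d powr p" (is "?L \<le> _")
proof (cases "?L \<le> 0")
  case False
  have "?L powr (1 / p) \<le> min_disc p \<gamma> N d"
    unfolding min_disc_def
  \<comment> \<open>Nonemptiness matters: an infimum over the empty set would carry no
    information.\<close>
  proof (rule cINF_greatest[OF point_sets_nonempty[OF d]])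
    fix P assume "P \<in> point_sets N d"
    then have "?L \<le> weighted_Lp_disc p \<gamma> d P powr p"
      using N p nn by (rule weighted_Lp_disc_lower)
    then have "?L powr (1 / p) \<le> (weighted_Lp_disc p \<gamma> d P powr p) powr (1 / p)"
      using False p by (intro powr_mono2) auto
    also have "\<dots> = weighted_Lp_disc p \<gamma> d P"
      using p by (simp add: powr_powr weighted_Lp_disc_nonneg)
    finally show "?L powr (1 / p) \<le> weighted_Lp_disc p \<gamma> d P" .
  qed
  then have "(?L powr (1 / p)) powr p \<le> min_disc p \<gamma> N d powr p"
    using p by (intro powr_mono2) auto
  then show ?thesis using False p by (simp add: powr_powr)
qed (use order_trans[OF _ powr_ge_zero] in blast)

lemma prod_one_plus_le_exp:
  fixes a :: "'i \<Rightarrow> real"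
  assumes "\<And>i. i \<in> A \<Longrightarrow> a i \<ge> 0"
  shows "(\<Prod>i\<in>A. 1 + a i) \<le> exp (\<Sum>i\<in>A. a i)"
proof (cases "finite A")
  case True
  have "(\<Prod>i\<in>A. 1 + a i) \<le> (\<Prod>i\<in>A. exp (a i))"
    using assms by (intro prod_mono) (auto intro: exp_ge_add_one_self add_nonneg_nonneg)
  then show ?thesis using True by (simp add: exp_sum)
qed auto

text \<open>With \<open>E \<ge> J 1\<close>, the condition on \<open>N\<close> says
  \<open>sqrt N \<ge> 2 * \<epsilon> powr (- p) * E\<close>, which brings the \<open>p\<close>-th
  power of the discrepancy down to \<open>\<epsilon> powr p\<close>.\<close>

lemma N_disc_admissible:
  assumes d: "d \<ge> 1" and \<epsilon>: "0 < \<epsilon>" and p: "p \<ge> 1"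
    and nn: "\<And>j. j \<in> {1..d} \<Longrightarrow> \<gamma> j \<ge> 0"
    and N: "N \<ge> 1" "4 * \<epsilon> powr (- 2 * p) * exp (2 * (\<Sum>j\<in>{1..d}. \<gamma> j powr (p / 2))) \<le> real N"
  shows "min_disc p \<gamma> N d \<le> \<epsilon> * initial_disc p \<gamma> d"
proof -
  define E where "E = exp (\<Sum>j\<in>{1..d}. \<gamma> j powr (p / 2))"
  have E: "E > 0" "exp (2 * (\<Sum>j\<in>{1..d}. \<gamma> j powr (p / 2))) = E\<^sup>2"
    by (simp_all add: E_def exp_double)
  have "(2 * \<epsilon> powr (- p) * E)\<^sup>2 = 4 * (\<epsilon> powr (- p))\<^sup>2 * E\<^sup>2" by (simp add: power_mult_distrib)
  also have "(\<epsilon> powr (- p))\<^sup>2 = \<epsilon> powr (- 2 * p)"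
    using \<epsilon> by (simp add: powr_power)
  finally have "(2 * \<epsilon> powr (- p) * E)\<^sup>2 \<le> real N" using N(2) E(2) by simp
  then have sqrt: "2 * \<epsilon> powr (- p) * E \<le> sqrt (real N)" by (rule real_le_rsqrt)
  obtain P where P: "P \<in> point_sets N d" and le: "weighted_Lp_disc p \<gamma> d P powr p
    \<le> 2 * (\<Prod>j\<in>{1..d}. 1 + \<gamma> j powr (p / 2)) / sqrt (real N)"
    using ex_point_set_small_disc[where \<gamma> = \<gamma>, OF d N(1) p nn] by blast
  note le
  also have "2 * (\<Prod>j\<in>{1..d}. 1 + \<gamma> j powr (p / 2)) / sqrt (real N) \<le> 2 * E / (2 * \<epsilon> powr (- p) * E)"
    using E(1) \<epsilon> sqrt unfolding E_def by (intro frac_le mult_left_mono prod_one_plus_le_exp) auto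
  also have "\<dots> = \<epsilon> powr p" using E(1) by (simp add: powr_minus field_simps)
  finally have "(weighted_Lp_disc p \<gamma> d P powr p) powr (1 / p) \<le> (\<epsilon> powr p) powr (1 / p)"
    using p by (intro powr_mono2[where a = "1 / p"]) auto
  then have "weighted_Lp_disc p \<gamma> d P \<le> \<epsilon>"
    using p \<epsilon> by (simp add: powr_powr weighted_Lp_disc_nonneg)
  \<comment> \<open>Absolute error \<open>\<epsilon>\<close> therefore implies relative error
    \<open>\<epsilon>\<close>.\<close>
  moreover have "1 \<le> initial_disc p \<gamma> d"
    unfolding initial_disc_def using p by (intro prod_ge_1 ge_one_powr_ge_zero) auto
  ultimately have "weighted_Lp_disc p \<gamma> d P \<le> \<epsilon> * initial_disc p \<gamma> d"
    using mult_left_mono[of 1 "initial_disc p \<gamma> d" \<epsilon>] \<epsilon> by linarith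
  with min_disc_le[OF P] show ?thesis by (rule order_trans)
qed

text \<open>An admissible \<open>N\<close> exists, so the \<open>LEAST\<close> in the definition is
  attained and not an unspecified value.\<close>

lemma N_disc_spec:
  assumes "d \<ge> 1" "0 < \<epsilon>" "p \<ge> 1" "\<And>j. j \<in> {1..d} \<Longrightarrow> \<gamma> j \<ge> 0"
  shows "N_disc p \<gamma> \<epsilon> d \<ge> 1 \<and> min_disc p \<gamma> (N_disc p \<gamma> \<epsilon> d) d \<le> \<epsilon> * initial_disc p \<gamma> d"
proof -
  obtain N where "max 1 (4 * \<epsilon> powr (- 2 * p) * exp (2 * (\<Sum>j\<in>{1..d}. \<gamma> j powr (p / 2)))) \<le> real N"
    using real_arch_simple by blast
  then have "N \<ge> 1 \<and> min_disc p \<gamma> N d \<le> \<epsilon> * initial_disc p \<gamma> d"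
    using N_disc_admissible[where \<gamma> = \<gamma> and N = N, OF assms] by simp
  then show ?thesis unfolding N_disc_def by (rule LeastI)
qed

lemma N_disc_upper:
  assumes d: "d \<ge> 1" and \<epsilon>: "0 < \<epsilon>" "\<epsilon> < 1" and p: "p \<ge> 1"
    and nn: "\<And>j. j \<in> {1..d} \<Longrightarrow> \<gamma> j \<ge> 0"
  shows "real (N_disc p \<gamma> \<epsilon> d)
    \<le> 5 * \<epsilon> powr (- 2 * p) * exp (2 * (\<Sum>j\<in>{1..d}. \<gamma> j powr (p / 2)))"
proof -
  define X where "X = \<epsilon> powr (- 2 * p) * exp (2 * (\<Sum>j\<in>{1..d}. \<gamma> j powr (p / 2)))"
  have "1 \<le> \<epsilon> powr (- 2 * p)"
    using \<epsilon> p powr_mono'[of "- 2 * p" 0 \<epsilon>] by simp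
  moreover have "1 \<le> exp (2 * (\<Sum>j\<in>{1..d}. \<gamma> j powr (p / 2)))" by (simp add: sum_nonneg)
  ultimately have X: "1 \<le> X"
    unfolding X_def using mult_mono[of 1 "\<epsilon> powr (- 2 * p)" 1] by fastforce
  \<comment> \<open>Rounding up costs at most \<open>1 \<le> X\<close>, which turns the factor
    \<open>4\<close> into \<open>5\<close>.\<close>
  define N where "N = nat \<lceil>4 * X\<rceil>"
  have N: "N \<ge> 1" "4 * X \<le> real N" "real N \<le> 5 * X"
    using X unfolding N_def by linarith+
  then have "N \<ge> 1 \<and> min_disc p \<gamma> N d \<le> \<epsilon> * initial_disc p \<gamma> d"
    using N_disc_admissible[where \<gamma> = \<gamma> and N = N, OF d \<epsilon>(1) p nn] by (simp add: X_def mult_ac)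
  then have "N_disc p \<gamma> \<epsilon> d \<le> N" unfolding N_disc_def by (rule Least_le)
  with N(3) show ?thesis by (simp add: X_def mult_ac)
qed

text \<open>With \<open>y = x / 2\<close>, the estimate \<open>exp y \<le> 1 + y + y * y\<close>
  gives \<open>1 + x / 2 + x * x / 4\<close>, and \<open>x * x \<le> x\<close>.\<close>

lemma exp_half_le_one_plus:
  fixes x :: real
  assumes "0 \<le> x" "x \<le> 1"
  shows "exp (x / 2) \<le> 1 + x"
  using exp_bound[of "x / 2"] assms mult_left_le[of x x] by (simp add: power2_eq_square)

text \<open>The \<open>p\<close>-th power of the defining inequality of \<open>N\<close> reads
  \<open>(1 - \<epsilon> powr p) * A \<le> 2 * N * B\<close>, where \<open>A\<close> and
  \<open>B\<close> are the two products of the lower bound. Their ratio is bounded below factor by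
  factor by exponentials.\<close>

lemma N_disc_lower:
  assumes d: "d \<ge> 1" and \<epsilon>: "0 < \<epsilon>" and p: "p \<ge> 1"
    and \<gamma>: "\<And>j. j \<in> {1..d} \<Longrightarrow> 0 \<le> \<gamma> j \<and> \<gamma> j \<le> 1"
  shows "(1 - \<epsilon> powr p) * exp ((\<Sum>j\<in>{1..d}. \<gamma> j powr (p / 2)) / (2 * (p + 1) * (p + 3)))
    \<le> 2 * real (N_disc p \<gamma> \<epsilon> d)"
proof (cases "\<epsilon> powr p \<le> 1")
  case True
  define N where "N = N_disc p \<gamma> \<epsilon> d"
  define g where "g j = \<gamma> j powr (p / 2)" for j
  define A where "A = (\<Prod>j\<in>{1..d}. 1 + g j / (p + 1))"
  define B where "B = (\<Prod>j\<in>{1..d}. 1 + g j / (p + 2))"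
  \<comment> \<open>The solution of
    \<open>\<kappa> * (1 + 1 / (p + 2)) = 1 / (p + 1) - 1 / (p + 2)\<close>; with
    \<open>g j \<le> 1\<close> this gives \<open>(1 + \<kappa> * g j) * (1 + g j / (p + 2)) \<le> 1
    + g j / (p + 1)\<close>.\<close>
  define \<kappa> where "\<kappa> = 1 / ((p + 1) * (p + 3))"
  have g: "0 \<le> g j \<and> g j \<le> 1" if "j \<in> {1..d}" for j
    using \<gamma>[OF that] p by (auto simp: g_def powr_le1)
  have N: "N \<ge> 1" and min: "min_disc p \<gamma> N d \<le> \<epsilon> * initial_disc p \<gamma> d"
    using N_disc_spec[where \<gamma> = \<gamma>, OF d \<epsilon> p] \<gamma> unfolding N_def by auto
  have "0 \<le> min_disc p \<gamma> N d"
    unfolding min_disc_def by (rule cINF_greatest[OF point_sets_nonempty[OF d] weighted_Lp_disc_nonneg])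
  then have "min_disc p \<gamma> N d powr p \<le> (\<epsilon> * initial_disc p \<gamma> d) powr p"
    using p min by (intro powr_mono2) auto
  also have "\<dots> = \<epsilon> powr p * (\<Prod>j\<in>{1..d}. ((1 + g j / (p + 1)) powr (1 / p)) powr p)"
    using \<epsilon> by (simp add: powr_mult initial_disc_def g_def prod_powr_distrib prod_nonneg)
  also have "(\<Prod>j\<in>{1..d}. ((1 + g j / (p + 1)) powr (1 / p)) powr p) = A"
    unfolding A_def using p g by (intro prod.cong refl) (simp add: powr_powr)
  finally have "A - 2 * real N * B \<le> \<epsilon> powr p * A"
    using min_disc_lower[of d N p \<gamma>] d N p \<gamma> unfolding A_def B_def g_def by fastforce
  then have AB: "(1 - \<epsilon> powr p) * A \<le> 2 * real N * B" by (simp add: algebra_simps)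
  have B: "B > 0" unfolding B_def using g p by (intro prod_pos) (simp add: add_pos_nonneg)
  have factor: "exp (\<kappa> * g j / 2) * (1 + g j / (p + 2)) \<le> 1 + g j / (p + 1)" if "j \<in> {1..d}" for j
  proof -
    have gj: "0 \<le> g j" "g j \<le> 1" using g[OF that] by auto
    have "\<kappa> \<le> 1" using p by (simp add: \<kappa>_def divide_simps mult_ge1_I)
    moreover have "0 \<le> \<kappa>" using p by (simp add: \<kappa>_def)
    ultimately have "exp (\<kappa> * g j / 2) \<le> 1 + \<kappa> * g j"
      using gj by (intro exp_half_le_one_plus) (auto simp: mult_le_one)
    then have "exp (\<kappa> * g j / 2) * (1 + g j / (p + 2)) \<le> (1 + \<kappa> * g j) * (1 + g j / (p + 2))"
      using gj p by (intro mult_right_mono) auto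
    also have "\<dots> = 1 + g j / (p + 2) + \<kappa> * g j * (1 + g j / (p + 2))" by (simp only: distrib_left distrib_right mult_1_left mult_1_right add_ac)
    also have "\<dots> \<le> 1 + g j / (p + 2) + \<kappa> * g j * (1 + 1 / (p + 2))"
      using gj p \<open>0 \<le> \<kappa>\<close> by (intro add_left_mono mult_left_mono divide_right_mono) auto
    also have "\<dots> = 1 + g j / (p + 1)"
      using p by (simp add: \<kappa>_def divide_simps) (simp add: algebra_simps)
    finally show ?thesis .
  qed
  have exponent: "(\<Sum>j\<in>{1..d}. g j) / (2 * (p + 1) * (p + 3)) = (\<Sum>j\<in>{1..d}. \<kappa> * g j / 2)"
    unfolding sum_divide_distrib \<kappa>_def using p by (intro sum.cong refl) (simp add: divide_simps)
  have "exp ((\<Sum>j\<in>{1..d}. g j) / (2 * (p + 1) * (p + 3))) * B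
      = (\<Prod>j\<in>{1..d}. exp (\<kappa> * g j / 2) * (1 + g j / (p + 2)))"
    unfolding exponent B_def by (simp only: exp_sum finite_atLeastAtMost prod.distrib)
  also have "\<dots> \<le> A"
    unfolding A_def using factor g p by (intro prod_mono) (auto intro!: mult_nonneg_nonneg)
  finally have "(1 - \<epsilon> powr p) * (exp ((\<Sum>j\<in>{1..d}. g j) / (2 * (p + 1) * (p + 3))) * B)
      \<le> (1 - \<epsilon> powr p) * A"
    using True by (intro mult_left_mono) auto
  with AB have "((1 - \<epsilon> powr p) * exp ((\<Sum>j\<in>{1..d}. g j) / (2 * (p + 1) * (p + 3)))) * B
      \<le> 2 * real N * B" by (simp add: mult_ac)
  then show ?thesis using B unfolding g_def N_def by (simp add: mult_le_cancel_right)
next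
  case False
  then have "(1 - \<epsilon> powr p) * exp ((\<Sum>j\<in>{1..d}. \<gamma> j powr (p / 2)) / (2 * (p + 1) * (p + 3))) \<le> 0"
    by (intro mult_nonpos_nonneg) auto
  then show ?thesis by (rule order_trans) simp
qed

text \<open>For \<open>p \<ge> 1\<close> the factor \<open>1 - (1/2) powr p\<close> is at least
  \<open>1 / 2\<close>. The single precision \<open>1/2\<close> serves all necessity proofs.\<close>

lemma N_disc_lower_half:
  assumes \<gamma>: "\<And>j. j \<ge> 1 \<Longrightarrow> 0 < \<gamma> j \<and> \<gamma> j \<le> 1" and d: "d \<ge> 1" and p: "p \<ge> 1"
  shows "exp ((\<Sum>j=1..d. \<gamma> j powr (p / 2)) / (2 * (p + 1) * (p + 3))) \<le> 4 * real (N_disc p \<gamma> (1/2) d)"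
proof -
  have "(1 - (1/2) powr p) * exp ((\<Sum>j=1..d. \<gamma> j powr (p / 2)) / (2 * (p + 1) * (p + 3)))
      \<le> 2 * real (N_disc p \<gamma> (1/2) d)"
    using \<gamma> by (intro N_disc_lower d p) (auto intro: less_imp_le)
  moreover have "(1/2) powr p \<le> (1/2 :: real) powr 1"
    using p by (intro powr_mono') auto
  then have "1 / 2 * exp ((\<Sum>j=1..d. \<gamma> j powr (p / 2)) / (2 * (p + 1) * (p + 3)))
    \<le> (1 - (1/2) powr p) * exp ((\<Sum>j=1..d. \<gamma> j powr (p / 2)) / (2 * (p + 1) * (p + 3)))"
    by (intro mult_right_mono) auto
  ultimately show ?thesis by linarith
qed

text \<open>In this form any growth bound on the inverse at precision \<open>1/2\<close> becomes a
  growth bound on the weight sums.\<close>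

lemma weight_sum_le_ln_N_disc:
  assumes \<gamma>: "\<And>j. j \<ge> 1 \<Longrightarrow> 0 < \<gamma> j \<and> \<gamma> j \<le> 1" and d: "d \<ge> 1" and p: "p \<ge> 1"
  shows "(\<Sum>j=1..d. \<gamma> j powr (p / 2)) \<le> 2 * (p + 1) * (p + 3) * (ln 4 + ln (real (N_disc p \<gamma> (1/2) d)))"
proof -
  have N: "N_disc p \<gamma> (1/2) d \<ge> 1"
    using N_disc_spec[OF d, of "1/2" p \<gamma>] p \<gamma> by (simp add: less_imp_le)
  have "(\<Sum>j=1..d. \<gamma> j powr (p / 2)) / (2 * (p + 1) * (p + 3)) \<le> ln (4 * real (N_disc p \<gamma> (1/2) d))"
    using N_disc_lower_half[where \<gamma> = \<gamma>, OF \<gamma> d p] N by (simp add: ln_ge_iff)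
  also have "\<dots> = ln 4 + ln (real (N_disc p \<gamma> (1/2) d))" using N by (simp add: ln_mult)
  finally show ?thesis using p by (simp add: pos_divide_le_eq mult.commute)
qed

section \<open>The three tractability criteria\<close>

lemma ln_N_disc_bounds:
  assumes \<gamma>: "\<And>j. j \<ge> 1 \<Longrightarrow> 0 < \<gamma> j \<and> \<gamma> j \<le> 1" and d: "d \<ge> 1" and p: "p \<ge> 1"
    and \<epsilon>: "0 < \<epsilon>" "\<epsilon> < 1"
  shows "0 \<le> ln (real (N_disc p \<gamma> \<epsilon> d))"
    "ln (real (N_disc p \<gamma> \<epsilon> d)) \<le> ln 5 + 2 * p * ln (1 / \<epsilon>) + 2 * (\<Sum>j=1..d. \<gamma> j powr (p / 2))"
proof -
  let ?s = "\<Sum>j=1..d. \<gamma> j powr (p / 2)"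
  have nn: "\<And>j. j \<in> {1..d} \<Longrightarrow> \<gamma> j \<ge> 0" using \<gamma> by (simp add: less_imp_le)
  have N: "N_disc p \<gamma> \<epsilon> d \<ge> 1" using N_disc_spec[where \<gamma> = \<gamma>, OF d \<epsilon>(1) p nn] by blast
  then show "0 \<le> ln (real (N_disc p \<gamma> \<epsilon> d))" by simp
  have "ln (real (N_disc p \<gamma> \<epsilon> d)) \<le> ln (5 * \<epsilon> powr (- 2 * p) * exp (2 * ?s))"
    using N_disc_upper[where \<gamma> = \<gamma>, OF d \<epsilon> p nn] N \<epsilon> by simp
  also have "\<dots> = ln 5 + 2 * p * ln (1 / \<epsilon>) + 2 * ?s"
    using \<epsilon> by (simp add: ln_mult ln_powr ln_div)
  finally show "ln (real (N_disc p \<gamma> \<epsilon> d)) \<le> ln 5 + 2 * p * ln (1 / \<epsilon>) + 2 * ?s" .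
qed

text \<open>Covers the finitely many dimensions below a threshold, where an asymptotic hypothesis
  says nothing.\<close>

lemma weight_sum_le:
  assumes \<gamma>: "\<And>j. j \<ge> 1 \<Longrightarrow> 0 < \<gamma> j \<and> \<gamma> j \<le> 1" and p: "p \<ge> 1"
  shows "(\<Sum>j=1..d. \<gamma> j powr (p / 2)) \<le> real d"
proof -
  have "(\<Sum>j=1..d. \<gamma> j powr (p / 2)) \<le> (\<Sum>j=1..d. 1)"
  proof (rule sum_mono)
    fix j assume "j \<in> {1..d}"
    then have "0 < \<gamma> j \<and> \<gamma> j \<le> 1" using \<gamma> by simp
    then show "\<gamma> j powr (p / 2) \<le> 1" using p by (intro powr_le1) auto
  qed
  then show ?thesis by simp
qed

text \<open>A bound on the inverse that is uniform in \<open>d\<close> bounds the partial sums of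
  the nonnegative series. Conversely, the sum of the series bounds the exponential factor in
  \<open>N_disc_upper\<close>.\<close>

lemma strongly_polynomially_tractable_iff:
  assumes \<gamma>: "\<And>j. j \<ge> 1 \<Longrightarrow> 0 < \<gamma> j \<and> \<gamma> j \<le> 1" and p: "p \<ge> 1"
  shows "strongly_polynomially_tractable p \<gamma> \<longleftrightarrow> summable (\<lambda>j. \<gamma> (Suc j) powr (p / 2))"
proof
  assume "strongly_polynomially_tractable p \<gamma>"
  then obtain C \<sigma> where C: "C > 0"
    and N: "\<And>\<epsilon> d. \<epsilon> \<in> {0<..<1} \<Longrightarrow> d \<ge> 1 \<Longrightarrow> real (N_disc p \<gamma> \<epsilon> d) \<le> C * \<epsilon> powr (- \<sigma>)"
    unfolding strongly_polynomially_tractable_def by metis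
  define K where "K = 2 * (p + 1) * (p + 3) * (ln 4 + ln (C * (1/2) powr (- \<sigma>)))"
  have bound: "(\<Sum>j=1..d. \<gamma> j powr (p / 2)) \<le> K" if d: "d \<ge> 1" for d
  proof -
    have "N_disc p \<gamma> (1/2) d \<ge> 1"
      using N_disc_spec[OF d, of "1/2" p \<gamma>] p \<gamma> by (simp add: less_imp_le)
    then have "ln (real (N_disc p \<gamma> (1/2) d)) \<le> ln (C * (1/2) powr (- \<sigma>))"
      using N[of "1/2" d] d C by simp
    then have "2 * (p + 1) * (p + 3) * (ln 4 + ln (real (N_disc p \<gamma> (1/2) d))) \<le> K"
      unfolding K_def using p by (intro mult_left_mono) auto
    with weight_sum_le_ln_N_disc[where \<gamma> = \<gamma>, OF \<gamma> d p] show ?thesis by linarith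
  qed
  show "summable (\<lambda>j. \<gamma> (Suc j) powr (p / 2))"
  proof (rule bounded_imp_summable)
    fix n
    have "(\<Sum>k\<le>n. \<gamma> (Suc k) powr (p / 2)) = (\<Sum>j=1..Suc n. \<gamma> j powr (p / 2))"
      by (rule sum.reindex_bij_witness[of _ "\<lambda>j. j - 1" Suc]) auto
    also have "\<dots> \<le> K" by (rule bound) simp
    finally show "(\<Sum>k\<le>n. \<gamma> (Suc k) powr (p / 2)) \<le> K" .
  qed simp
next
  assume summable: "summable (\<lambda>j. \<gamma> (Suc j) powr (p / 2))"
  define S where "S = (\<Sum>j. \<gamma> (Suc j) powr (p / 2))"
  show "strongly_polynomially_tractable p \<gamma>"
    unfolding strongly_polynomially_tractable_def
  proof (rule exI[of _ "5 * exp (2 * S)"], rule exI[of _ "2 * p"], intro conjI ballI allI impI)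
    fix \<epsilon> :: real and d :: nat
    assume \<epsilon>: "\<epsilon> \<in> {0<..<1}" and d: "1 \<le> d"
    have "(\<Sum>j=1..d. \<gamma> j powr (p / 2)) = (\<Sum>j<d. \<gamma> (Suc j) powr (p / 2))"
      by (rule sum.reindex_bij_witness[of _ Suc "\<lambda>j. j - 1"]) auto
    also have "\<dots> \<le> S" unfolding S_def by (rule sum_le_suminf[OF summable]) auto
    finally have sum: "(\<Sum>j=1..d. \<gamma> j powr (p / 2)) \<le> S" .
    have "real (N_disc p \<gamma> \<epsilon> d) \<le> 5 * \<epsilon> powr (- 2 * p) * exp (2 * (\<Sum>j=1..d. \<gamma> j powr (p / 2)))"
      using \<epsilon> \<gamma> by (intro N_disc_upper d p) (auto intro: less_imp_le)
    also have "\<dots> \<le> 5 * \<epsilon> powr (- 2 * p) * exp (2 * S)"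
      using sum by (intro mult_left_mono) auto
    finally show "real (N_disc p \<gamma> \<epsilon> d) \<le> 5 * exp (2 * S) * \<epsilon> powr - (2 * p)"
      by (simp add: mult_ac)
  qed (use p in auto)
qed

lemma polynomially_tractable_iff:
  assumes \<gamma>: "\<And>j. j \<ge> 1 \<Longrightarrow> 0 < \<gamma> j \<and> \<gamma> j \<le> 1" and p: "p \<ge> 1"
  shows "polynomially_tractable p \<gamma> \<longleftrightarrow>
    limsup (\<lambda>d. ereal (1 / ln (real d) * (\<Sum>j=1..d. \<gamma> j powr (p / 2)))) < \<infinity>"
proof
  assume "polynomially_tractable p \<gamma>"
  then obtain C \<sigma> \<tau> where C: "C > 0" and \<tau>: "\<tau> \<ge> 0"
    and N: "\<And>\<epsilon> d. \<epsilon> \<in> {0<..<1} \<Longrightarrow> d \<ge> 1 \<Longrightarrow> real (N_disc p \<gamma> \<epsilon> d) \<le> C * real d powr \<tau> * \<epsilon> powr (- \<sigma>)"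
    unfolding polynomially_tractable_def by metis
  define a where "a = 2 * (p + 1) * (p + 3)"
  \<comment> \<open>The absolute value makes \<open>b\<close> nonnegative, so that
    \<open>b \<le> b * ln (real d)\<close> once \<open>ln (real d) \<ge> 1\<close>.\<close>
  define b where "b = \<bar>ln 4 + ln (C * (1/2) powr (- \<sigma>))\<bar>"
  have a: "a \<ge> 0" unfolding a_def using p by simp
  \<comment> \<open>From \<open>d \<ge> 3\<close> on, \<open>d\<close> exceeds \<open>exp 1\<close>,
    and the logarithm is at least \<open>1\<close>.\<close>
  have "1 / ln (real d) * (\<Sum>j=1..d. \<gamma> j powr (p / 2)) \<le> a * (b + \<tau>)" if d: "d \<ge> 3" for d
  proof -
    have "exp 1 \<le> real d" using d exp_le by linarith
    then have ln_d: "1 \<le> ln (real d)" using d by (subst ln_ge_iff) auto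
    have "N_disc p \<gamma> (1/2) d \<ge> 1"
      using N_disc_spec[of d "1/2" p \<gamma>] d p \<gamma> by (simp add: less_imp_le)
    then have "ln (real (N_disc p \<gamma> (1/2) d)) \<le> ln (C * real d powr \<tau> * (1/2) powr (- \<sigma>))"
      using N[of "1/2" d] d C by simp
    also have "\<dots> = ln (C * (1/2) powr (- \<sigma>)) + \<tau> * ln (real d)"
      using C d by (simp add: ln_mult ln_powr)
    finally have "ln 4 + ln (real (N_disc p \<gamma> (1/2) d)) \<le> b + \<tau> * ln (real d)"
      unfolding b_def by linarith
    also have "b \<le> b * ln (real d)"
      using ln_d mult_left_mono[of 1 "ln (real d)" b] by (simp add: b_def)
    finally have "a * (ln 4 + ln (real (N_disc p \<gamma> (1/2) d))) \<le> a * (b * ln (real d) + \<tau> * ln (real d))"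
      using a by (intro mult_left_mono) auto
    then have "(\<Sum>j=1..d. \<gamma> j powr (p / 2)) \<le> a * (b + \<tau>) * ln (real d)"
      using weight_sum_le_ln_N_disc[where \<gamma> = \<gamma> and d = d, OF \<gamma> _ p] d unfolding a_def
      by (simp add: algebra_simps)
    then show ?thesis using ln_d by (simp add: pos_divide_le_eq)
  qed
  then have "limsup (\<lambda>d. ereal (1 / ln (real d) * (\<Sum>j=1..d. \<gamma> j powr (p / 2)))) \<le> ereal (a * (b + \<tau>))"
    by (intro Limsup_bounded eventually_sequentiallyI[of 3]) auto
  then show "limsup (\<lambda>d. ereal (1 / ln (real d) * (\<Sum>j=1..d. \<gamma> j powr (p / 2)))) < \<infinity>"
    by (rule le_less_trans) simp
next
  assume "limsup (\<lambda>d. ereal (1 / ln (real d) * (\<Sum>j=1..d. \<gamma> j powr (p / 2)))) < \<infinity>"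
  then obtain B :: real where "limsup (\<lambda>d. ereal (1 / ln (real d) * (\<Sum>j=1..d. \<gamma> j powr (p / 2)))) < ereal B"
    using less_PInf_Ex_of_nat by auto
  then have "\<forall>\<^sub>F d in sequentially. ereal (1 / ln (real d) * (\<Sum>j=1..d. \<gamma> j powr (p / 2))) < ereal B"
    by (rule Limsup_lessD)
  then obtain d0 where d0: "\<And>d. d \<ge> d0 \<Longrightarrow> 1 / ln (real d) * (\<Sum>j=1..d. \<gamma> j powr (p / 2)) < B"
    by (auto simp: eventually_sequentially)
  \<comment> \<open>The threshold \<open>d0 + 2\<close> also makes \<open>ln (real d)\<close>
    positive; below it the weight sum is at most \<open>d \<le> d0 + 1\<close>.\<close>
  have bound: "(\<Sum>j=1..d. \<gamma> j powr (p / 2)) \<le> real (d0 + 1) + \<bar>B\<bar> * ln (real d)" if d: "d \<ge> 1" for d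
  proof (cases "d \<ge> d0 + 2")
    case True
    then have "ln (real d) > 0" "1 / ln (real d) * (\<Sum>j=1..d. \<gamma> j powr (p / 2)) < B"
      using d0[of d] by auto
    then have "(\<Sum>j=1..d. \<gamma> j powr (p / 2)) \<le> B * ln (real d)" by (simp add: pos_divide_less_eq)
    also have "\<dots> \<le> \<bar>B\<bar> * ln (real d)" using \<open>ln (real d) > 0\<close> by (intro mult_right_mono) auto
    finally show ?thesis by simp
  next
    case False
    have "(\<Sum>j=1..d. \<gamma> j powr (p / 2)) \<le> real d"
      using \<gamma> p by (rule weight_sum_le)
    also have "\<dots> \<le> real (d0 + 1)" using False by simp
    finally show ?thesis using d by (simp add: add_increasing2)
  qed
  show "polynomially_tractable p \<gamma>"
    unfolding polynomially_tractable_def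
  \<comment> \<open>The part \<open>2 * \<bar>B\<bar> * ln (real d)\<close> of the exponent becomes
    a power of \<open>d\<close>; the absolute value ensures \<open>\<tau> \<ge> 0\<close>.\<close>
  proof (rule exI[of _ "5 * exp (2 * real (d0 + 1))"], rule exI[of _ "2 * p"], rule exI[of _ "2 * \<bar>B\<bar>"],
      intro conjI ballI allI impI)
    fix \<epsilon> :: real and d :: nat
    assume \<epsilon>: "\<epsilon> \<in> {0<..<1}" and d: "1 \<le> d"
    have "real (N_disc p \<gamma> \<epsilon> d) \<le> 5 * \<epsilon> powr (- 2 * p) * exp (2 * (\<Sum>j=1..d. \<gamma> j powr (p / 2)))"
      using \<epsilon> \<gamma> by (intro N_disc_upper d p) (auto intro: less_imp_le)
    also have "\<dots> \<le> 5 * \<epsilon> powr (- 2 * p) * exp (2 * (real (d0 + 1) + \<bar>B\<bar> * ln (real d)))"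
      using bound[OF d] by (intro mult_left_mono) auto
    also have "exp (2 * (real (d0 + 1) + \<bar>B\<bar> * ln (real d))) = exp (2 * real (d0 + 1)) * real d powr (2 * \<bar>B\<bar>)"
      using d by (simp add: powr_def exp_add distrib_left mult_ac)
    finally show "real (N_disc p \<gamma> \<epsilon> d) \<le>
        5 * exp (2 * real (d0 + 1)) * real d powr (2 * \<bar>B\<bar>) * \<epsilon> powr - (2 * p)"
      by (simp add: mult_ac)
  qed (use p in auto)
qed

lemma weakly_tractable_iff:
  assumes \<gamma>: "\<And>j. j \<ge> 1 \<Longrightarrow> 0 < \<gamma> j \<and> \<gamma> j \<le> 1" and p: "p \<ge> 1"
  shows "weakly_tractable p \<gamma> \<longleftrightarrow> (\<lambda>d. 1 / real d * (\<Sum>j=1..d. \<gamma> j powr (p / 2))) \<longlonglongrightarrow> 0"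
    (is "_ \<longleftrightarrow> ?avg \<longlonglongrightarrow> 0")
proof
  assume "weakly_tractable p \<gamma>"
  \<comment> \<open>The joint limit is restricted to the path \<open>\<epsilon> = 1/2\<close>,
    \<open>d\<close> tending to infinity, along which the denominator is
    \<open>d + 2\<close>.\<close>
  moreover have "filterlim (\<lambda>d. (1/2, d))
      (inf (filtercomap (\<lambda>(\<epsilon>, d). real d + 1 / \<epsilon>) at_top) (principal ({0<..<1} \<times> {1..}))) sequentially"
    unfolding filterlim_inf filterlim_principal filterlim_filtercomap_iff o_def
  proof
    show "filterlim (\<lambda>d. case (1/2, d) of (\<epsilon>, d) \<Rightarrow> real d + 1 / \<epsilon>) at_top sequentially"
      using filterlim_tendsto_add_at_top[OF tendsto_const[of "1 / (1 / 2)"] filterlim_real_sequentially]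
      by (simp add: add.commute)
    show "\<forall>\<^sub>F d in sequentially. (1/2, d) \<in> {0<..<1::real} \<times> {1::nat..}"
      by (intro eventually_sequentiallyI[of 1]) auto
  qed
  ultimately have lim: "(\<lambda>d. ln (real (N_disc p \<gamma> (1/2) d)) / (real d + 2)) \<longlonglongrightarrow> 0"
    unfolding weakly_tractable_def by (auto dest: filterlim_compose)
  define a where "a = 2 * (p + 1) * (p + 3)"
  have a: "a \<ge> 0" unfolding a_def using p by simp
  show "?avg \<longlonglongrightarrow> 0"
  proof (rule tendsto_sandwich)
    show "\<forall>\<^sub>F d in sequentially. 0 \<le> ?avg d"
      by (simp add: sum_nonneg)
    show "\<forall>\<^sub>F d in sequentially. ?avg d \<le>
        a * (ln 4 / real d + ln (real (N_disc p \<gamma> (1/2) d)) / (real d + 2) * ((real d + 2) / real d))"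
    proof (rule eventually_sequentiallyI[of 1])
      fix d :: nat assume d: "1 \<le> d"
      have "?avg d \<le> 1 / real d * (a * (ln 4 + ln (real (N_disc p \<gamma> (1/2) d))))"
        using weight_sum_le_ln_N_disc[where \<gamma> = \<gamma>, OF \<gamma> d p] unfolding a_def
        by (intro mult_left_mono) auto
      also have "\<dots> = a * (ln 4 / real d + ln (real (N_disc p \<gamma> (1/2) d)) / (real d + 2) * ((real d + 2) / real d))"
      proof -
        have "real d + 2 \<noteq> 0" by linarith
        then have "ln (real (N_disc p \<gamma> (1/2) d)) / (real d + 2) * ((real d + 2) / real d)
            = ln (real (N_disc p \<gamma> (1/2) d)) / real d" by simp
        then show ?thesis by (simp only:) (simp add: add_divide_distrib distrib_left)
      qed
      finally show "?avg d \<le> \<dots>" .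
    qed
    have "(\<lambda>d. ln 4 / real d) \<longlonglongrightarrow> 0" by (rule lim_const_over_n)
    moreover have "(\<lambda>d. 1 + 2 / real d) \<longlonglongrightarrow> 1 + 0"
      by (intro tendsto_add tendsto_const lim_const_over_n)
    then have "(\<lambda>d. (real d + 2) / real d) \<longlonglongrightarrow> 1 + 0"
      by (rule Lim_transform_eventually) (auto intro!: eventually_sequentiallyI[of 1] simp: add_divide_distrib)
    ultimately have "(\<lambda>d. a * (ln 4 / real d + ln (real (N_disc p \<gamma> (1/2) d)) / (real d + 2) * ((real d + 2) / real d)))
        \<longlonglongrightarrow> a * (0 + 0 * (1 + 0))"
      using lim by (intro tendsto_mult tendsto_add tendsto_const)
    then show "(\<lambda>d. a * (ln 4 / real d + ln (real (N_disc p \<gamma> (1/2) d)) / (real d + 2) * ((real d + 2) / real d)))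
        \<longlonglongrightarrow> 0" by simp
  qed simp
next
  assume avg: "?avg \<longlonglongrightarrow> 0"
  show "weakly_tractable p \<gamma>"
    unfolding weakly_tractable_def
  proof (rule tendstoI)
    fix \<delta> :: real assume \<delta>: "\<delta> > 0"
    \<comment> \<open>Chosen so that \<open>(2 * p + 2) * \<eta> = \<delta> / 2\<close>; the other
      half of \<open>\<delta>\<close> is left for the constant \<open>K\<close>.\<close>
    define \<eta> where "\<eta> = \<delta> / (4 * p + 4)"
    have \<eta>: "\<eta> > 0" using \<delta> p by (simp add: \<eta>_def)
    obtain d0 where d0: "\<And>d. d \<ge> d0 \<Longrightarrow> \<bar>?avg d\<bar> < \<eta>"
      using LIMSEQ_D[OF avg \<eta>] by auto
    have sum_le: "(\<Sum>j=1..d. \<gamma> j powr (p / 2)) \<le> real d0 + \<eta> * real d" if d: "d \<ge> 1" for d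
    proof (cases "d \<ge> d0")
      case True
      then have "?avg d \<le> \<eta>" using d0[of d] by linarith
      then have "(\<Sum>j=1..d. \<gamma> j powr (p / 2)) \<le> \<eta> * real d" using d by (simp add: pos_divide_le_eq)
      then show ?thesis by simp
    next
      case False
      have "(\<Sum>j=1..d. \<gamma> j powr (p / 2)) \<le> real d"
        using \<gamma> p by (rule weight_sum_le)
      also have "\<dots> \<le> real d0" using False by simp
      finally show ?thesis using \<eta> by (simp add: add_increasing2)
    qed
    \<comment> \<open>The logarithm of \<open>1 / \<epsilon>\<close> is absorbed by an arbitrarily
      small multiple of \<open>1 / \<epsilon>\<close>, up to a constant.\<close>
    have ln_le: "ln x \<le> \<eta> * x + ln (1 / \<eta>)" if "x > 0" for x
    proof -
      have "ln (\<eta> * x) \<le> \<eta> * x - 1" using that \<eta> by (intro ln_le_minus_one) simp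
      then show ?thesis using that \<eta> by (simp add: ln_mult ln_div)
    qed
    define K where "K = ln 5 + 2 * p * ln (1 / \<eta>) + 2 * real d0"
    have main: "dist (ln (real (N_disc p \<gamma> \<epsilon> d)) / (real d + 1 / \<epsilon>)) 0 < \<delta>"
      if \<epsilon>: "\<epsilon> \<in> {0<..<1}" and d: "d \<ge> 1" and large: "2 * K / \<delta> < real d + 1 / \<epsilon>" for \<epsilon> d
    proof -
      let ?s = "real d + 1 / \<epsilon>"
      have s: "0 < ?s" and \<epsilon>': "0 < 1 / \<epsilon>" using \<epsilon> by (auto intro: add_nonneg_pos)
      have "ln (real (N_disc p \<gamma> \<epsilon> d)) \<le> ln 5 + 2 * p * ln (1 / \<epsilon>) + 2 * (\<Sum>j=1..d. \<gamma> j powr (p / 2))"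
        using ln_N_disc_bounds(2)[where \<gamma> = \<gamma>, OF \<gamma> d p] \<epsilon> by simp
      also have "\<dots> \<le> ln 5 + 2 * p * (\<eta> * (1 / \<epsilon>) + ln (1 / \<eta>)) + 2 * (real d0 + \<eta> * real d)"
        using ln_le[OF \<epsilon>'] sum_le[OF d] p by (intro add_mono mult_left_mono) auto
      also have "\<dots> = K + 2 * p * \<eta> * (1 / \<epsilon>) + 2 * \<eta> * real d"
        by (simp add: K_def algebra_simps)
      also have "\<dots> \<le> K + (2 * p + 2) * \<eta> * (1 / \<epsilon>) + (2 * p + 2) * \<eta> * real d"
        using \<epsilon>' \<eta> p by (intro add_mono mult_right_mono) auto
      also have "\<dots> = K + (2 * p + 2) * \<eta> * ?s" by (simp add: algebra_simps)
      also have "(2 * p + 2) * \<eta> = \<delta> / 2" using p by (simp add: \<eta>_def field_simps)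
      also have "K + \<delta> / 2 * ?s < \<delta> * ?s"
      proof -
        have "2 * K < \<delta> * ?s" using large \<delta> by (simp only: pos_divide_less_eq mult.commute)
        then show ?thesis by linarith
      qed
      finally have "ln (real (N_disc p \<gamma> \<epsilon> d)) / ?s < \<delta>" using s by (simp add: pos_divide_less_eq)
      moreover have "0 \<le> ln (real (N_disc p \<gamma> \<epsilon> d)) / ?s"
        using ln_N_disc_bounds(1)[where \<gamma> = \<gamma>, OF \<gamma> d p] \<epsilon> s by simp
      ultimately show ?thesis unfolding dist_real_def by linarith
    qed
    show "\<forall>\<^sub>F x in inf (filtercomap (\<lambda>(\<epsilon>, d). real d + 1 / \<epsilon>) at_top) (principal ({0<..<1} \<times> {1..})).
        dist (case x of (\<epsilon>, d) \<Rightarrow> ln (real (N_disc p \<gamma> \<epsilon> d)) / (real d + 1 / \<epsilon>)) 0 < \<delta>"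
      unfolding eventually_inf_principal eventually_filtercomap
    proof (intro exI[of _ "\<lambda>s. 2 * K / \<delta> < s"] conjI allI impI)
      show "\<forall>\<^sub>F s in at_top. 2 * K / \<delta> < s" by (rule eventually_gt_at_top)
      fix x :: "real \<times> nat"
      assume "2 * K / \<delta> < (case x of (\<epsilon>, d) \<Rightarrow> real d + 1 / \<epsilon>)" "x \<in> {0<..<1} \<times> {1..}"
      then show "dist (case x of (\<epsilon>, d) \<Rightarrow> ln (real (N_disc p \<gamma> \<epsilon> d)) / (real d + 1 / \<epsilon>)) 0 < \<delta>"
        using main[of "fst x" "snd x"] by (simp add: case_prod_beta mem_Times_iff)
    qed
  qed
qed

theorem corollary2:
  fixes \<gamma> :: "nat \<Rightarrow> real"
  assumes weights: "\<And>j. j \<ge> 1 \<Longrightarrow> 0 < \<gamma> j \<and> \<gamma> j \<le> 1"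
  shows
    "(\<forall>n::nat. even n \<and> n > 0 \<longrightarrow>
        (strongly_polynomially_tractable (real n) \<gamma> \<longleftrightarrow>
         summable (\<lambda>j. \<gamma> (Suc j) powr (real n / 2))))
   \<and> ((\<forall>p::real. p > 1 \<longrightarrow>
        (polynomially_tractable p \<gamma> \<longleftrightarrow>
         limsup (\<lambda>d. ereal (1 / ln (real d) * (\<Sum>j=1..d. \<gamma> j powr (p / 2)))) < \<infinity>))
      \<and> (limsup (\<lambda>d. ereal (1 / ln (real d) * (\<Sum>j=1..d. \<gamma> j powr (1 / 2)))) < \<infinity>
         \<longrightarrow> polynomially_tractable 1 \<gamma>))
   \<and> ((\<forall>p::real. p > 1 \<longrightarrow>
        (weakly_tractable p \<gamma> \<longleftrightarrow>
         (\<lambda>d. 1 / real d * (\<Sum>j=1..d. \<gamma> j powr (p / 2))) \<longlonglongrightarrow> 0))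
      \<and> ((\<lambda>d. 1 / real d * (\<Sum>j=1..d. \<gamma> j powr (1 / 2))) \<longlonglongrightarrow> 0
         \<longrightarrow> weakly_tractable 1 \<gamma>))"
proof (intro conjI allI impI)
  fix n :: nat assume "even n \<and> n > 0"
  then have "real n \<ge> 1" by simp
  with weights show "strongly_polynomially_tractable (real n) \<gamma> \<longleftrightarrow>
      summable (\<lambda>j. \<gamma> (Suc j) powr (real n / 2))"
    by (rule strongly_polynomially_tractable_iff)
next
  fix p :: real assume "p > 1"
  then have p: "p \<ge> 1" by simp
  show "polynomially_tractable p \<gamma> \<longleftrightarrow>
      limsup (\<lambda>d. ereal (1 / ln (real d) * (\<Sum>j=1..d. \<gamma> j powr (p / 2)))) < \<infinity>"
    using weights p by (rule polynomially_tractable_iff)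
  show "weakly_tractable p \<gamma> \<longleftrightarrow> (\<lambda>d. 1 / real d * (\<Sum>j=1..d. \<gamma> j powr (p / 2))) \<longlonglongrightarrow> 0"
    using weights p by (rule weakly_tractable_iff)
\<comment> \<open>What remains are the sufficiency claims for \<open>p = 1\<close>.\<close>
qed (use polynomially_tractable_iff[where \<gamma> = \<gamma> and p = 1, OF weights]
    weakly_tractable_iff[where \<gamma> = \<gamma> and p = 1, OF weights] in simp_all)

end
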